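(* Let $0<\alpha<1$, $m>1$, $0<X<1$, and let $y$ be the nontrivial solution on $[0,1]$ of $$y(z)^{m+1}=\int_0^z K(z,u)\,y(u)\,du ,$$ with $K$ as in the context, considered on $0\le z\le X$. For $N\in\mathbb{N}$ let $h=1/N$, $z_n=nh$, $K_{n,i}=K(z_n,z_i)$, and let $y_n$ be computed by the midpoint method: $y_0=0$, $$y_1=\left(\frac{\alpha}{2}\right)^{2-\alpha}\frac{\Gamma\left(\frac{2-\alpha}{m}\right)}{\Gamma\left(1-\alpha+\frac{2-\alpha}{m}\right)}\,\frac{h^{\frac{2-\alpha}{m}}}{(2-\alpha)\left(1+\frac1m\right)-1},$$ $$y_{2n+k}^{m+1}=\frac12 h K_{2n+k,k}\,y_k+2h\sum_{i=1}^{n}K_{2n+k,2i+k-1}\,y_{2i+k-1},\qquad k\in\{0,1\},\quad n\ge 1.$$ Put $$D=\frac{m+1}{2m}\,\frac{1}{\Gamma(2-\alpha)}\left(\frac{1}{1-X}\right)^{1-\alpha},\qquad A=\frac{2D}{(m+1)C_1^m},$$ with $C_1$ as in the context. If $$m>2-\alpha\qquad\text{and}\qquad A<\alpha+\frac{2-\alpha}{m},$$ then the method is convergent, and its order of convergence is at least $$2-(2-\alpha)\left(1-\frac1m\right)-\frac{2D}{(m+1)C_1^m}.$$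
   Context: Kernel: for $0\le u\le z<1$, $$K(z,u)=\frac{m+1}{m}\frac{1}{\Gamma(1-\alpha)}\int_{\left(\frac{1-z}{1-u}\right)^{\alpha/2}}^1\left(s^{\frac2\alpha}(1-u)-\left(1-\tfrac{\alpha}{2}\right)(1-z)\right)s^{\frac2\alpha}(1-s)^{-\alpha}\,ds ,$$ extended continuously to $z=1$. Solution: $y:[0,1]\to[0,\infty)$ denotes the nontrivial (not identically zero) continuous solution of the integral equation (its existence and uniqueness are known). It is known that $C_1 z^{(2-\alpha)/m}\le y(z)\le C_2 z^{(2-\alpha)/m}$ for $0\le z\le 1$, where $C_2=\Gamma(3-\alpha)^{-1/(m+1)}$ and $C_1$ is the constant $$C_1=\left(\left(\tfrac{\alpha}{2}\right)^{1-\alpha}\frac{\Gamma\left(\frac{2-\alpha}{m}\right)}{\Gamma\left(2-\alpha+\frac{2-\alpha}{m}\right)}\,\frac{1}{2-\alpha+m(3-\alpha)}\right)^{\frac1{m+1}}\quad\text{if } 0<\alpha\le 1-\tfrac1{m+1},$$ $$C_1=\left(\left(\tfrac{\alpha}{2}\right)^{2-\alpha}\frac{\Gamma\left(1+\frac{2-\alpha}{m}\right)}{\Gamma\left(2-\alpha+\frac{2-\alpha}{m}\right)}\,\frac{1}{2-\alpha}\right)^{\frac1{m+1}}\quad\text{if } 1-\tfrac1{m+1}<\alpha\le 1.$$ Convergence: with $e_n:=y_n-y(nh)$, the method is convergent if $|e_n|\to0$ as $h\to0^+$ with $nh\to z$ for fixed $z\in(0,X]$, $nh\le X$; its order is at least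 $p$ if $|e_n|\le \mathrm{const.}\times h^{p}$ in this limit, with a constant independent of $h$. *)

theory Defs
  imports "HOL-Analysis.Analysis" "HOL-Library.Landau_Symbols"
begin

(* Intended for 0 <= u <= z <= 1. At z = 1 no separate clause is needed: since 0 powr a = 0 and
   0 / 0 = 0, the formula has the value of the continuous extension there (in particular 0 at
   z = u = 1). *)
definition kernel :: "real \<Rightarrow> real \<Rightarrow> real \<Rightarrow> real \<Rightarrow> real" where
  "kernel \<alpha> m z u =
     (m + 1) / m * (1 / Gamma (1 - \<alpha>)) *
     integral {((1 - z) / (1 - u)) powr (\<alpha> / 2)..1}
       (\<lambda>s. (s powr (2 / \<alpha>) * (1 - u) - (1 - \<alpha> / 2) * (1 - z)) *
            s powr (2 / \<alpha>) * (1 - s) powr (- \<alpha>))"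

(* Nontriviality is positivity on (0,1]. Merely excluding the zero function would not determine y:
   with any solution y and 0 < c < 1, the function that is 0 on [0,c] and
   (1 - c) powr (2 / m) * y ((z - c) / (1 - c)) on [c,1] is again a continuous nonnegative
   solution, because kernel is homogeneous of degree 1 in (1 - z, 1 - u). *)
definition nontrivial_solution :: "real \<Rightarrow> real \<Rightarrow> (real \<Rightarrow> real) \<Rightarrow> bool" where
  "nontrivial_solution \<alpha> m y \<longleftrightarrow>
     continuous_on {0..1} y \<and>
     (\<forall>z\<in>{0..1}. 0 \<le> y z) \<and>
     (\<forall>z\<in>{0<..1}. 0 < y z) \<and>
     (\<forall>z\<in>{0..1}. y z powr (m + 1) = integral {0..z} (\<lambda>u. kernel \<alpha> m z u * y u))"

definition C1 :: "real \<Rightarrow> real \<Rightarrow> real" where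
  "C1 \<alpha> m =
     (if \<alpha> \<le> 1 - 1 / (m + 1)
      then ((\<alpha> / 2) powr (1 - \<alpha>)
            * (Gamma ((2 - \<alpha>) / m) / Gamma (2 - \<alpha> + (2 - \<alpha>) / m))
            * (1 / (2 - \<alpha> + m * (3 - \<alpha>)))) powr (1 / (m + 1))
      else ((\<alpha> / 2) powr (2 - \<alpha>)
            * (Gamma (1 + (2 - \<alpha>) / m) / Gamma (2 - \<alpha> + (2 - \<alpha>) / m))
            * (1 / (2 - \<alpha>))) powr (1 / (m + 1)))"

definition D_const :: "real \<Rightarrow> real \<Rightarrow> real \<Rightarrow> real" where
  "D_const \<alpha> m X =
     (m + 1) / (2 * m) * (1 / Gamma (2 - \<alpha>)) * (1 / (1 - X)) powr (1 - \<alpha>)"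

(* v is the sequence of nodal values for step h = 1/N. The recursion is imposed at the nodes of
   [0,X] only; the values are the nonnegative (m+1)-th roots. *)
definition midpoint_scheme :: "real \<Rightarrow> real \<Rightarrow> real \<Rightarrow> nat \<Rightarrow> (nat \<Rightarrow> real) \<Rightarrow> bool" where
  "midpoint_scheme \<alpha> m X N v \<longleftrightarrow>
     (let h = 1 / real N; K = (\<lambda>n i. kernel \<alpha> m (real n * h) (real i * h)) in
        v 0 = 0 \<and>
        v 1 = (\<alpha> / 2) powr (2 - \<alpha>)
              * (Gamma ((2 - \<alpha>) / m) / Gamma (1 - \<alpha> + (2 - \<alpha>) / m))
              * (h powr ((2 - \<alpha>) / m) / ((2 - \<alpha>) * (1 + 1 / m) - 1)) \<and>
        (\<forall>n\<ge>1. \<forall>k\<in>{0, 1}. real (2 * n + k) * h \<le> X \<longrightarrow>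
           0 \<le> v (2 * n + k) \<and>
           v (2 * n + k) powr (m + 1) =
             1 / 2 * h * K (2 * n + k) k * v k
             + 2 * h * (\<Sum>i = 1..n. K (2 * n + k) (2 * i + k - 1) * v (2 * i + k - 1))))"

(* The limit h = 1/N \<rightarrow> 0+ with n h \<rightarrow> z and n h \<le> X, as a filter on pairs (N, n). *)
definition grid_limit :: "real \<Rightarrow> real \<Rightarrow> (nat \<times> nat) filter" where
  "grid_limit X z =
     inf (filtercomap fst at_top)
       (inf (filtercomap (\<lambda>(N, n). real n / real N) (nhds z))
            (principal {(N, n). real n / real N \<le> X}))"

definition grid_error :: "(real \<Rightarrow> real) \<Rightarrow> (nat \<Rightarrow> nat \<Rightarrow> real) \<Rightarrow> nat \<times> nat \<Rightarrow> real" where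
  "grid_error y Y = (\<lambda>(N, n). Y N n - y (real n / real N))"

definition method_convergent ::
    "real \<Rightarrow> (real \<Rightarrow> real) \<Rightarrow> (nat \<Rightarrow> nat \<Rightarrow> real) \<Rightarrow> bool" where
  "method_convergent X y Y \<longleftrightarrow>
     (\<forall>z\<in>{0<..X}. ((\<lambda>p. \<bar>grid_error y Y p\<bar>) \<longlongrightarrow> 0) (grid_limit X z))"

definition convergence_order_at_least ::
    "real \<Rightarrow> (real \<Rightarrow> real) \<Rightarrow> (nat \<Rightarrow> nat \<Rightarrow> real) \<Rightarrow> real \<Rightarrow> bool" where
  "convergence_order_at_least X y Y q \<longleftrightarrow>
     (\<forall>z\<in>{0<..X}. grid_error y Y \<in> O[grid_limit X z](\<lambda>(N, n). (1 / real N) powr q))"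

end

theory Submission
  imports Defs
begin

text \<open>
  The factor \<open>(1 - x) powr (2 / m)\<close> splits off: \<open>p x = (1 - x) powr (- (2 / m)) * y x\<close> satisfies
  \<open>p x powr (m + 1) = (\<integral> u = 0..x. L x u * p u)\<close>, where \<open>L\<close> is decreasing in \<open>u\<close>, behaves like
  \<open>(x - u) powr (1 - \<alpha>)\<close> at the diagonal and is homogeneous under the affine maps that fix 1
  (\<open>scaled_kernel_volterra\<close>). In the coordinate \<open>- ln (1 - x)\<close> this is a convolution equation, so it
  is invariant under shifts: \<open>p \<circ> rescale \<sigma>\<close> solves it with a shifted origin (\<open>p_rescale_eq\<close>).

  A subsolution that vanishes near 0 lies below \<open>p\<close> (\<open>subsolution_le\<close>). Applied to shifted copies
  of \<open>p\<close> this shows that \<open>p\<close> is increasing; applied to shifted powers it gives the lower one of the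
  two bounds of order \<open>x powr \<gamma>\<close> with \<open>\<gamma> = (2 - \<alpha>) / m\<close>. From these bounds and shift invariance
  follows a Lipschitz estimate relative to the size of \<open>p\<close> and to the distance from 0
  (\<open>p_relative_lipschitz\<close>).

  The convergence proof is a comparison as well. The error of the scheme acts like a displacement of
  the origin of the solution, so the computed values are enclosed between values of shifted
  solutions, \<open>p (rescale (1 - s') (n h)) \<le> V n \<le> p (rescale (1 + s) (n h))\<close>, with shifts that grow
  slowly with \<open>n\<close>. The kernel is decreasing, so by summation by parts (\<open>weighted_sum_le\<close>,
  \<open>weighted_sum_ge\<close>) it is enough to compare the partial sums of the midpoint values with integrals
  of \<open>p\<close>. This reduces to a condition on neighbouring nodes: the increment of the shifts must
  outweigh the variation of \<open>p\<close> over one cell, which relative to \<open>p\<close> is \<open>O(1 / n)\<close>. Shifts of size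
  \<open>M h n powr \<theta>\<close> with any \<open>0 < \<theta> < 1\<close> and large \<open>M\<close> achieve this (\<open>midpoint_upper_bound\<close>,
  \<open>midpoint_lower_bound\<close>), and the error at a fixed point is \<open>O(h powr (1 - \<theta>))\<close>.

  Finally the order \<open>q\<close> in the theorem lies strictly between 0 and 1: it is positive by the assumed
  inequality, and it is below 1 because \<open>C1 \<alpha> m \<le> 1\<close> and \<open>Gamma (2 - \<alpha>) \<le> 1\<close> (\<open>rate_less_1\<close>). Thus
  \<open>\<theta> = 1 - q\<close> is admissible. Convergence follows from \<open>q > 0\<close>.
\<close>

section \<open>Auxiliary inequalities for real powers\<close>

text \<open>
  Bernoulli's inequality for exponents below 1: the graph of a concave power lies below its
  tangent at 1.
\<close>

lemma powr_le_linear: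
  fixes x \<theta> :: real
  assumes "0 \<le> x" "0 < \<theta>" "\<theta> \<le> 1"
  shows "x powr \<theta> \<le> 1 + \<theta> * (x - 1)"
proof (cases "x = 0")
  case True
  then show ?thesis using assms by simp
next
  case False
  then have "x powr \<theta> * 1 powr (1 - \<theta>) \<le> \<theta> * x + (1 - \<theta>) * 1"
    using assms by (intro Youngs_inequality_0) auto
  then show ?thesis by (simp add: algebra_simps)
qed

lemma powr_increment_ge:
  fixes a b \<theta> :: real
  assumes "0 \<le> a" "0 < b" "0 < \<theta>" "\<theta> \<le> 1"
  shows "\<theta> * b powr (\<theta> - 1) * (b - a) \<le> b powr \<theta> - a powr \<theta>"
proof -
  have "(a / b) powr \<theta> \<le> 1 + \<theta> * (a / b - 1)"
    using assms by (intro powr_le_linear) auto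
  then have "b powr \<theta> * (a / b) powr \<theta> \<le> b powr \<theta> * (1 + \<theta> * (a / b - 1))"
    by (intro mult_left_mono) auto
  moreover have "b powr \<theta> * (a / b) powr \<theta> = a powr \<theta>"
    using assms by (simp add: powr_divide)
  moreover have "b powr (\<theta> - 1) = b powr \<theta> / b"
    using assms by (simp add: powr_diff)
  then have "b powr \<theta> * (1 + \<theta> * (a / b - 1)) = b powr \<theta> - \<theta> * b powr (\<theta> - 1) * (b - a)"
    using assms by (simp add: field_simps)
  ultimately show ?thesis by linarith
qed

lemma powr_le_cancel:
  fixes a b e :: real
  assumes "a powr e \<le> b powr e" "0 \<le> a" "0 \<le> b" "0 < e"
  shows "a \<le> b"
  using assms by (meson linorder_not_le powr_less_mono2)

section \<open>The rescalings fixing the end point 1\<close>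

text \<open>
  The affine map with fixed point 1 and slope \<open>1 / \<sigma>\<close>. In the coordinate \<open>- ln (1 - u)\<close> it is
  the translation by \<open>ln \<sigma>\<close>, so \<open>\<sigma> = 1 + s\<close> moves the points near 0 to the right by about \<open>s\<close>, and
  \<open>\<sigma> = 1 - s\<close> moves them to the left.
\<close>

definition rescale :: "real \<Rightarrow> real \<Rightarrow> real" where
  "rescale \<sigma> u = 1 - (1 - u) / \<sigma>"

lemma one_minus_rescale: "1 - rescale \<sigma> u = (1 - u) / \<sigma>"
  by (simp add: rescale_def)

lemma rescale_mult: "\<sigma> \<noteq> 0 \<Longrightarrow> \<sigma> * rescale \<sigma> u = \<sigma> - 1 + u"
  by (simp add: rescale_def field_simps)

lemma rescale_mono_factor: "\<lbrakk>u \<le> 1; 0 < \<sigma>; \<sigma> \<le> \<tau>\<rbrakk> \<Longrightarrow> rescale \<sigma> u \<le> rescale \<tau> u"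
  by (auto simp: rescale_def intro!: divide_left_mono)

lemma rescale_le_iff [simp]: "0 < \<sigma> \<Longrightarrow> rescale \<sigma> u \<le> rescale \<sigma> v \<longleftrightarrow> u \<le> v"
  by (simp add: rescale_def divide_le_cancel)

lemma rescale_less_1 [simp]: "0 < \<sigma> \<Longrightarrow> rescale \<sigma> u < 1 \<longleftrightarrow> u < 1"
  by (simp add: rescale_def zero_less_divide_iff)

lemma continuous_on_rescale [continuous_intros]: "continuous_on S (rescale \<sigma>)"
  unfolding rescale_def divide_inverse by (intro continuous_intros)

lemma has_integral_rescale:
  assumes \<sigma>: "0 < \<sigma>" and f: "(f has_integral i) {rescale \<sigma> a..rescale \<sigma> b}"
  shows "((\<lambda>u. f (rescale \<sigma> u)) has_integral \<sigma> * i) {a..b}"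
proof -
  have 1: "(f has_integral i) (cbox (rescale \<sigma> a) (rescale \<sigma> b))" using f by simp
  have 2: "rescale \<sigma> u = (1 / \<sigma>) *\<^sub>R u + (1 - 1 / \<sigma>)" for u
    using \<sigma> by (simp add: rescale_def field_simps)
  have 3: "(rescale \<sigma> u - (1 - 1 / \<sigma>)) /\<^sub>R (1 / \<sigma>) = u" for u
    using \<sigma> by (simp add: rescale_def field_simps)
  from has_integral_affinity'[OF 1, of "1 / \<sigma>" "1 - 1 / \<sigma>"] \<sigma>
  show ?thesis unfolding 3 2[symmetric] by simp
qed

section \<open>Volterra equations with a homogeneous kernel\<close>

text \<open>
  The properties of the kernel on which everything rests. The scaling law makes the
  equation invariant under the maps \<^const>\<open>rescale\<close>. Monotonicity in the second argument replaces
  any smoothness in the quadrature estimates. The power bounds fix the behaviour at the diagonal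
  and hence the growth of solutions at 0.
\<close>

locale volterra_kernel =
  fixes \<alpha> m :: real and L :: "real \<Rightarrow> real \<Rightarrow> real"
  assumes \<alpha>: "0 < \<alpha>" "\<alpha> < 1" and m: "0 < m"
    and L_nonneg: "\<lbrakk>u \<le> z; z < 1\<rbrakk> \<Longrightarrow> 0 \<le> L z u"
    and L_antimono: "\<lbrakk>u \<le> v; v \<le> z; z < 1\<rbrakk> \<Longrightarrow> L z v \<le> L z u"
    and L_rescale: "\<lbrakk>u \<le> z; z < 1; 0 < \<sigma>\<rbrakk> \<Longrightarrow> L (rescale \<sigma> z) (rescale \<sigma> u) = \<sigma> * L z u"
    and L_lower: "b < 1 \<Longrightarrow> \<exists>l>0. \<forall>z u. 0 \<le> u \<and> u \<le> z \<and> z \<le> b \<longrightarrow> l * (z - u) powr (1 - \<alpha>) \<le> L z u"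
    and L_upper: "b < 1 \<Longrightarrow> \<exists>l>0. \<forall>z u. 0 \<le> u \<and> u \<le> z \<and> z \<le> b \<longrightarrow> L z u \<le> l * (z - u) powr (1 - \<alpha>)"
begin

definition \<gamma> :: real where "\<gamma> = (2 - \<alpha>) / m"

lemma \<gamma>_pos: "0 < \<gamma>" and \<gamma>_eq: "\<gamma> * m = 2 - \<alpha>"
  using \<alpha> m by (auto simp: \<gamma>_def)

lemma powr_\<gamma>_powr_m: "0 \<le> c \<Longrightarrow> (c * x powr \<gamma>) powr m = c powr m * x powr (2 - \<alpha>)"
  by (subst powr_mult) (simp_all only: powr_powr \<gamma>_eq powr_ge_zero)

text \<open>
  The kernel is monotone in its second argument, hence measurable and bounded on compact
  intervals.
\<close>

lemma L_integrable:
  assumes g: "continuous_on {a..b} g" and "b \<le> z" "z < 1"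
  shows "(\<lambda>u. L z u * g u) integrable_on {a..b}"
proof -
  have "mono_on {a..b} (\<lambda>u. - L z u)"
    using assms L_antimono by (auto simp: mono_on_def)
  then have "(\<lambda>u. - L z u) integrable_on {a..b}" by (rule integrable_on_mono_on)
  then have "L z integrable_on {a..b}" using integrable_neg_iff by blast
  then have L: "L z absolutely_integrable_on {a..b}"
    using assms L_nonneg by (intro nonnegative_absolutely_integrable_1) auto
  have "g \<in> borel_measurable (lebesgue_on {a..b})"
    using g by (intro continuous_imp_measurable_on_sets_lebesgue) auto
  moreover have "bounded (g ` {a..b})"
    using g by (intro compact_imp_bounded compact_continuous_image) auto
  ultimately have "(\<lambda>u. g u * L z u) absolutely_integrable_on {a..b}"
    using L by (intro absolutely_integrable_bounded_measurable_product_real) auto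
  then have "(\<lambda>u. g u * L z u) integrable_on {a..b}"
    using absolutely_integrable_on_def by blast
  then show ?thesis by (simp add: mult.commute)
qed

end

text \<open>
  The solution is extended by 0 to the left of 0. Then its shifted copies are defined on the whole
  half line, and the lower limit of the integral may be any nonpositive number.
\<close>

locale volterra_solution = volterra_kernel +
  fixes p :: "real \<Rightarrow> real"
  assumes p_cont: "continuous_on {0..<1} p"
    and p_neg: "x \<le> 0 \<Longrightarrow> p x = 0"
    and p_pos: "\<lbrakk>0 < x; x < 1\<rbrakk> \<Longrightarrow> 0 < p x"
    and p_eq: "\<lbrakk>0 \<le> x; x < 1\<rbrakk> \<Longrightarrow> p x powr (m + 1) = integral {0..x} (\<lambda>u. L x u * p u)"
begin

lemma p_nonneg: "x < 1 \<Longrightarrow> 0 \<le> p x"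
  using p_neg[of x] p_pos[of x] by (cases "x \<le> 0") auto

lemma p_continuous: "continuous_on {..<1} p"
proof -
  have "continuous_on {..<1} (\<lambda>t. if t \<le> 0 then 0 else p t)"
    using p_neg by (intro continuous_on_cases_1 continuous_on_const continuous_on_subset[OF p_cont]) auto
  moreover have eq: "(\<lambda>t. if t \<le> 0 then 0 else p t) = p" using p_neg by auto
  ultimately show ?thesis unfolding eq by simp
qed

lemma p_continuous_sub: "b < 1 \<Longrightarrow> continuous_on {a..b} p"
  by (rule continuous_on_subset[OF p_continuous]) auto

lemma Lp_integrable: "\<lbrakk>b \<le> z; z < 1\<rbrakk> \<Longrightarrow> (\<lambda>u. L z u * p u) integrable_on {a..b}"
  by (rule L_integrable) (auto intro: p_continuous_sub)

lemma p_eq_from: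
  assumes "a \<le> 0" "0 \<le> x" "x < 1"
  shows "((\<lambda>u. L x u * p u) has_integral p x powr (m + 1)) {a..x}"
proof -
  have "((\<lambda>u. L x u * p u) has_integral 0) {a..0}"
    by (rule has_integral_is_0) (auto simp: p_neg)
  moreover have "((\<lambda>u. L x u * p u) has_integral p x powr (m + 1)) {0..x}"
    using Lp_integrable[of x x 0] assms by (simp add: p_eq has_integral_integral)
  ultimately have "((\<lambda>u. L x u * p u) has_integral 0 + p x powr (m + 1)) {a..x}"
    by (rule has_integral_combine[OF assms(1,2)])
  then show ?thesis by simp
qed

text \<open>
  The substitution \<open>v = rescale \<sigma> u\<close> turns the equation at \<open>rescale \<sigma> x\<close> into one at \<open>x\<close>: the factor
  \<open>\<sigma>\<close> from the measure cancels the factor from homogeneity.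
\<close>

lemma p_rescale_eq:
  assumes "0 < \<sigma>" "x < 1" "rescale \<sigma> a \<le> 0" "0 \<le> rescale \<sigma> x"
  shows "((\<lambda>u. L x u * p (rescale \<sigma> u)) has_integral p (rescale \<sigma> x) powr (m + 1)) {a..x}"
proof -
  have "((\<lambda>v. L (rescale \<sigma> x) v * p v) has_integral p (rescale \<sigma> x) powr (m + 1))
          {rescale \<sigma> a..rescale \<sigma> x}"
    using assms by (intro p_eq_from) auto
  from has_integral_mult_right[OF has_integral_rescale[OF assms(1) this], of "1 / \<sigma>"]
  have "((\<lambda>u. 1 / \<sigma> * (L (rescale \<sigma> x) (rescale \<sigma> u) * p (rescale \<sigma> u)))
          has_integral p (rescale \<sigma> x) powr (m + 1)) {a..x}"
    using assms by simp
  then show ?thesis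
    by (rule has_integral_eq[rotated]) (use assms in \<open>simp add: L_rescale\<close>)
qed

text \<open>
  A comparison principle. Let \<open>t\<close> be the maximum of \<open>\<phi> / p\<close>, which is finite because \<open>p\<close> is bounded
  below on \<open>[c, b]\<close>. From \<open>\<phi> \<le> t p\<close> one gets \<open>\<phi>\<^sup>m\<^sup>+\<^sup>1 \<le> t p\<^sup>m\<^sup>+\<^sup>1\<close>, so \<open>t \<le> t powr (1 / (m + 1))\<close>, which
  forces \<open>t \<le> 1\<close>.
\<close>

lemma subsolution_le:
  assumes "0 < c" "b < 1" and cont: "continuous_on {0..b} \<phi>"
    and nonneg: "\<And>u. u \<in> {0..b} \<Longrightarrow> 0 \<le> \<phi> u" and zero: "\<And>u. u \<in> {0..c} \<Longrightarrow> \<phi> u = 0"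
    and sub: "\<And>z. z \<in> {c..b} \<Longrightarrow> \<phi> z powr (m + 1) \<le> integral {0..z} (\<lambda>u. L z u * \<phi> u)"
    and x: "x \<in> {0..b}"
  shows "\<phi> x \<le> p x"
proof (cases "x \<le> c")
  case True
  then show ?thesis using zero[of x] p_nonneg[of x] x assms(2) by auto
next
  case False
  with x have cx: "c \<le> b" by auto
  have "continuous_on {c..b} (\<lambda>u. \<phi> u / p u)"
    using assms(1,2) p_pos
    by (intro continuous_intros continuous_on_subset[OF cont] p_continuous_sub) (auto simp: less_le)
  then obtain w where w: "w \<in> {c..b}" "\<And>u. u \<in> {c..b} \<Longrightarrow> \<phi> u / p u \<le> \<phi> w / p w"
    using continuous_attains_sup[of "{c..b}" "\<lambda>u. \<phi> u / p u"] cx by auto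
  define t where "t = \<phi> w / p w"
  have wpos: "0 < p w" using w assms by (intro p_pos) auto
  have t0: "0 \<le> t" unfolding t_def using wpos nonneg[of w] w(1) assms(1) by (intro divide_nonneg_pos) auto
  have le: "\<phi> u \<le> t * p u" if "u \<in> {0..b}" for u
  proof (cases "u \<le> c")
    case True
    then show ?thesis using zero[of u] t0 p_nonneg[of u] that assms(2) by auto
  next
    case False
    then have "0 < p u" using that assms by (intro p_pos) auto
    then show ?thesis using w(2)[of u] False that by (simp add: t_def field_simps)
  qed
  have "t \<le> 1"
  proof (rule ccontr)
    assume "\<not> t \<le> 1"
    then have t1: "1 < t" by simp
    have "(t * p w) powr (m + 1) = \<phi> w powr (m + 1)" using wpos by (simp add: t_def)
    also have "\<dots> \<le> integral {0..w} (\<lambda>u. L w u * \<phi> u)" by (rule sub) (use w in auto)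
    also have "\<dots> \<le> integral {0..w} (\<lambda>u. t * (L w u * p u))"
    proof (rule integral_le)
      show "(\<lambda>u. L w u * \<phi> u) integrable_on {0..w}"
        by (rule L_integrable) (use w assms in \<open>auto intro: continuous_on_subset[OF cont]\<close>)
      show "(\<lambda>u. t * (L w u * p u)) integrable_on {0..w}"
        using integrable_cmul[OF Lp_integrable[of w w 0], of t] w assms by simp
      fix u assume u: "u \<in> {0..w}"
      have "L w u * \<phi> u \<le> L w u * (t * p u)"
        using u w assms by (intro mult_left_mono le L_nonneg) auto
      then show "L w u * \<phi> u \<le> t * (L w u * p u)" by (simp add: algebra_simps)
    qed
    also have "\<dots> = t * p w powr (m + 1)"
      using w assms by (simp add: p_eq)
    finally have "t powr (m + 1) * p w powr (m + 1) \<le> t * p w powr (m + 1)"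
      using t0 wpos by (simp add: powr_mult)
    then have "t powr (m + 1) \<le> t powr 1" using wpos t0 by simp
    moreover have "t powr 1 < t powr (m + 1)" using t1 m by (intro powr_less_mono) auto
    ultimately show False by simp
  qed
  then have "t * p x \<le> 1 * p x"
    using x assms p_nonneg[of x] by (intro mult_right_mono) auto
  then show ?thesis using order_trans[OF le[OF x]] by simp
qed

text \<open>
  A copy of \<open>p\<close> shifted to the right is a solution that vanishes on an initial interval, so it lies
  below \<open>p\<close> by the comparison principle.
\<close>

lemma p_mono: 
  assumes "x \<le> y" "y < 1"
  shows "p x \<le> p y"
proof (cases "0 < x \<and> x < y")
  case False
  then show ?thesis using assms p_neg[of x] p_nonneg[of y] by (cases "x = y") auto
next
  case True
  define \<sigma> where "\<sigma> = (1 - y) / (1 - x)"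
  have \<sigma>: "0 < \<sigma>" "\<sigma> < 1" using True assms by (auto simp: \<sigma>_def)
  have xy: "rescale \<sigma> y = x" using True assms by (simp add: rescale_def \<sigma>_def)
  have le: "rescale \<sigma> u \<le> 0" if "u \<le> 1 - \<sigma>" for u using that \<sigma> by (simp add: rescale_def field_simps)
  have ge: "0 \<le> rescale \<sigma> u" if "1 - \<sigma> \<le> u" for u using that \<sigma> by (simp add: rescale_def field_simps)
  have "p (rescale \<sigma> y) \<le> p y"
  proof (rule subsolution_le[where c = "1 - \<sigma>" and b = y])
    show "continuous_on {0..y} (\<lambda>u. p (rescale \<sigma> u))"
      using \<sigma> assms
      by (intro continuous_on_compose2[OF p_continuous] continuous_intros) auto
    show "p (rescale \<sigma> z) powr (m + 1) \<le> integral {0..z} (\<lambda>u. L z u * p (rescale \<sigma> u))"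
      if "z \<in> {1 - \<sigma>..y}" for z
    proof -
      have "((\<lambda>u. L z u * p (rescale \<sigma> u)) has_integral p (rescale \<sigma> z) powr (m + 1)) {0..z}"
        using \<sigma> assms that by (intro p_rescale_eq le ge) auto
      then show ?thesis by (simp add: integral_unique)
    qed
  qed (use \<sigma> assms True le p_neg in \<open>auto intro!: p_nonneg\<close>)
  then show ?thesis by (simp add: xy)
qed

text \<open>
  The functions \<open>\<kappa> (x - c)\<^sub>+ powr \<gamma>\<close> are subsolutions for small \<open>\<kappa>\<close>: both sides of the inequality
  scale with the same power of \<open>x - c\<close>, since \<open>\<gamma> (m + 1) = 2 - \<alpha> + \<gamma>\<close>. They vanish on \<open>[0, c]\<close>, so
  the comparison principle applies, and \<open>c\<close> may tend to 0.
\<close>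

lemma p_ge_power:
  assumes b: "b < 1"
  obtains \<kappa> where "0 < \<kappa>" "\<And>x. \<lbrakk>0 \<le> x; x \<le> b\<rbrakk> \<Longrightarrow> \<kappa> * x powr \<gamma> \<le> p x"
proof -
  obtain l where l: "0 < l"
    "\<And>z u. \<lbrakk>0 \<le> u; u \<le> z; z \<le> b\<rbrakk> \<Longrightarrow> l * (z - u) powr (1 - \<alpha>) \<le> L z u"
    using L_lower[OF b] by blast
  define K where "K = l * (1/4) powr (1 - \<alpha>) * (1/2) powr \<gamma> / 4"
  have K: "0 < K" using l(1) by (simp add: K_def)
  define \<kappa> where "\<kappa> = K powr (1 / m)"
  have \<kappa>: "0 < \<kappa>" using K by (simp add: \<kappa>_def)
  have \<kappa>K: "\<kappa> powr (m + 1) = K * \<kappa>" 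
    using K m by (simp add: \<kappa>_def powr_powr powr_add)
  have exps: "\<gamma> * (m + 1) = (1 - \<alpha>) + 1 + \<gamma>" using \<gamma>_eq by (simp add: algebra_simps)
  have main: "\<kappa> * max 0 (x - c) powr \<gamma> \<le> p x" if "0 < c" "0 \<le> x" "x \<le> b" for x c
  proof (rule subsolution_le[where c = c and b = b and \<phi> = "\<lambda>u. \<kappa> * max 0 (u - c) powr \<gamma>"])
    show cont: "continuous_on {0..b} (\<lambda>u. \<kappa> * max 0 (u - c) powr \<gamma>)"
      using \<gamma>_pos by (intro continuous_intros continuous_on_powr') auto
    fix z assume z: "z \<in> {c..b}"
    show "(\<kappa> * max 0 (z - c) powr \<gamma>) powr (m + 1)
          \<le> integral {0..z} (\<lambda>u. L z u * (\<kappa> * max 0 (u - c) powr \<gamma>))"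
    proof (cases "z = c")
      case True
      then show ?thesis using m that z b
        by (auto intro!: integral_nonneg L_integrable continuous_on_subset[OF cont] mult_nonneg_nonneg L_nonneg \<kappa>[THEN less_imp_le])
    next
      case False
      define d where "d = z - c"
      have d: "0 < d" using False z by (auto simp: d_def)
      have dz: "0 \<le> c + d/2" "c + 3*d/4 \<le> z" "c + 3*d/4 \<le> b"
        using d z that(1) by (auto simp: d_def field_simps)
      \<comment> \<open>The integral over this short piece is already of the right order in d.\<close>
      have pieces: "l * (d/4) powr (1 - \<alpha>) * (\<kappa> * (d/2) powr \<gamma>) \<le> L z u * (\<kappa> * max 0 (u - c) powr \<gamma>)"
        if u: "u \<in> {c + d/2..c + 3*d/4}" for u
      proof (rule mult_mono)
        have "u \<le> c + 3*d/4" using u by simp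
        then have du: "d/4 \<le> z - u" by (simp add: d_def field_simps)
        have "l * (d/4) powr (1 - \<alpha>) \<le> l * (z - u) powr (1 - \<alpha>)"
          using du d l(1) \<alpha> by (intro mult_left_mono powr_mono2) auto
        also have "\<dots> \<le> L z u" using u du d z \<open>0 < c\<close> by (intro l(2)) auto
        finally show "l * (d/4) powr (1 - \<alpha>) \<le> L z u" .
        show "\<kappa> * (d/2) powr \<gamma> \<le> \<kappa> * max 0 (u - c) powr \<gamma>"
          using u d \<kappa> \<gamma>_pos by (intro mult_left_mono powr_mono2) auto
        show "0 \<le> L z u" using du z b d by (intro L_nonneg) auto
      qed (use \<kappa> in auto)
      have "(\<kappa> * max 0 (z - c) powr \<gamma>) powr (m + 1) = \<kappa> powr (m + 1) * d powr (\<gamma> * (m + 1))"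
        using \<kappa> d by (simp add: powr_mult powr_powr d_def)
      also have "\<dots> = K * \<kappa> * (d powr (1 - \<alpha>) * d * d powr \<gamma>)"
      proof -
        have "d powr ((1 - \<alpha>) + 1 + \<gamma>) = d powr (1 - \<alpha>) * d * d powr \<gamma>"
          using d by (simp only: powr_add powr_one less_imp_le)
        then show ?thesis by (simp only: exps \<kappa>K)
      qed
      also have "\<dots> = (l * (d/4) powr (1 - \<alpha>) * (\<kappa> * (d/2) powr \<gamma>)) * (d / 4)"
        using d by (simp add: K_def powr_divide field_simps)
      also have "\<dots> = integral {c + d/2..c + 3*d/4} (\<lambda>u. l * (d/4) powr (1 - \<alpha>) * (\<kappa> * (d/2) powr \<gamma>))"
        using d by (simp add: algebra_simps)
      also have "\<dots> \<le> integral {c + d/2..c + 3*d/4} (\<lambda>u. L z u * (\<kappa> * max 0 (u - c) powr \<gamma>))"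
        by (rule integral_le)
          (use pieces z b dz in \<open>auto intro!: L_integrable continuous_on_subset[OF cont]\<close>)
      also have "\<dots> \<le> integral {0..z} (\<lambda>u. L z u * (\<kappa> * max 0 (u - c) powr \<gamma>))"
        by (rule integral_subset_le)
          (use z b that(1) dz \<kappa> in \<open>auto intro!: L_integrable continuous_on_subset[OF cont] mult_nonneg_nonneg L_nonneg\<close>)
      finally show ?thesis .
    qed
  qed (use that b \<kappa> in auto)
  have "\<kappa> * x powr \<gamma> \<le> p x" if "0 \<le> x" "x \<le> b" for x
  proof (cases "x = 0")
    case True
    then show ?thesis using p_neg by simp
  next
    case False
    have lim: "((\<lambda>c. \<kappa> * max 0 (x - c) powr \<gamma>) \<longlongrightarrow> \<kappa> * max 0 (x - 0) powr \<gamma>) (at_right 0)"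
      using False that by (intro tendsto_intros) auto
    have "\<kappa> * max 0 (x - 0) powr \<gamma> \<le> p x"
      by (rule tendsto_upperbound[OF lim]) 
         (use main that in \<open>auto simp: eventually_at_right_field intro!: exI[of _ 1]\<close>)
    then show ?thesis using that by simp
  qed
  then show thesis using that \<kappa> by blast
qed

text \<open>
  Since \<open>p\<close> is increasing, the equation gives \<open>p x powr (m + 1) \<le> x * sup (L x) * p x\<close>; one factor
  \<open>p x\<close> cancels.
\<close>

lemma p_le_power:
  assumes b: "b < 1"
  obtains \<kappa> where "0 < \<kappa>" "\<And>x. \<lbrakk>0 \<le> x; x \<le> b\<rbrakk> \<Longrightarrow> p x \<le> \<kappa> * x powr \<gamma>"
proof -
  obtain l where l: "0 < l"
    "\<And>z u. \<lbrakk>0 \<le> u; u \<le> z; z \<le> b\<rbrakk> \<Longrightarrow> L z u \<le> l * (z - u) powr (1 - \<alpha>)"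
    using L_upper[OF b] by blast
  have "p x \<le> l powr (1 / m) * x powr \<gamma>" if x: "0 \<le> x" "x \<le> b" for x
  proof (cases "x = 0")
    case True
    then show ?thesis using p_neg by simp
  next
    case False
    then have px: "0 < p x" using p_pos x b by auto
    have "p x powr (m + 1) = integral {0..x} (\<lambda>u. L x u * p u)" using p_eq x b by auto
    also have "\<dots> \<le> integral {0..x} (\<lambda>u. l * x powr (1 - \<alpha>) * p x)"
    proof (rule integral_le)
      fix u assume u: "u \<in> {0..x}"
      have "L x u \<le> l * (x - u) powr (1 - \<alpha>)" using u x by (intro l(2)) auto
      also have "\<dots> \<le> l * x powr (1 - \<alpha>)" using u x l(1) \<alpha> by (intro mult_left_mono powr_mono2) auto
      finally show "L x u * p u \<le> l * x powr (1 - \<alpha>) * p x"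
        using u x b l(1) by (intro mult_mono p_mono p_nonneg) auto
    qed (use x b in \<open>auto intro: Lp_integrable\<close>)
    also have "\<dots> = l * x powr (2 - \<alpha>) * p x"
      using x False powr_add[of x "1 - \<alpha>" 1] by (simp add: algebra_simps)
    finally have "p x powr m \<le> l * x powr (2 - \<alpha>)"
      using px by (simp add: powr_add)
    also have "\<dots> = (l powr (1 / m) * x powr \<gamma>) powr m"
      using l(1) m by (subst powr_\<gamma>_powr_m) (simp_all add: powr_powr)
    finally have le: "p x powr m \<le> (l powr (1 / m) * x powr \<gamma>) powr m" .
    show ?thesis by (rule powr_le_cancel[OF le]) (use px l(1) m in auto)
  qed
  then show thesis using that[of "l powr (1 / m)"] l(1) by auto
qed

text \<open>
  The two power bounds have the same exponent.
\<close>

lemma p_doubling: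
  assumes "b < 1" "0 < r"
  obtains C where "1 \<le> C" "\<And>x y. \<lbrakk>0 \<le> y; y \<le> r * x; x \<le> b; y \<le> b\<rbrakk> \<Longrightarrow> p y \<le> C * p x"
proof -
  obtain \<kappa> where \<kappa>: "0 < \<kappa>" "\<And>x. \<lbrakk>0 \<le> x; x \<le> b\<rbrakk> \<Longrightarrow> \<kappa> * x powr \<gamma> \<le> p x"
    using p_ge_power[OF assms(1)] by blast
  obtain \<kappa>' where \<kappa>': "0 < \<kappa>'" "\<And>x. \<lbrakk>0 \<le> x; x \<le> b\<rbrakk> \<Longrightarrow> p x \<le> \<kappa>' * x powr \<gamma>"
    using p_le_power[OF assms(1)] by blast
  define C where "C = max 1 (\<kappa>' * r powr \<gamma> / \<kappa>)"
  have "p y \<le> C * p x" if "0 \<le> y" "y \<le> r * x" "x \<le> b" "y \<le> b" for x y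
  proof -
    have x: "0 \<le> x" using that assms(2) by (meson order_trans zero_le_mult_iff not_less)
    have "p y \<le> \<kappa>' * y powr \<gamma>" using that by (intro \<kappa>') auto
    also have "\<dots> \<le> \<kappa>' * (r * x) powr \<gamma>" 
      using that \<kappa>'(1) \<gamma>_pos by (intro mult_left_mono powr_mono2) auto
    also have "\<dots> = \<kappa>' * r powr \<gamma> / \<kappa> * (\<kappa> * x powr \<gamma>)"
      using \<kappa>(1) x assms(2) by (simp add: powr_mult)
    also have "\<dots> \<le> C * (\<kappa> * x powr \<gamma>)" using \<kappa>(1) by (intro mult_right_mono) (auto simp: C_def)
    also have "\<dots> \<le> C * p x" using x that by (intro mult_left_mono \<kappa>) (auto simp: C_def)
    finally show ?thesis .
  qed
  then show thesis using that[of C] by (auto simp: C_def)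
qed

text \<open>
  Comparing sums with integrals of \<open>p\<close> against a decreasing weight reduces to comparing partial
  sums with this antiderivative.
\<close>

definition \<Phi> :: "real \<Rightarrow> real" where "\<Phi> x = integral {0..x} p"

lemma \<Phi>_neg: "x \<le> 0 \<Longrightarrow> \<Phi> x = 0"
  by (cases "x = 0") (auto simp: \<Phi>_def)

lemma p_integrable: "b < 1 \<Longrightarrow> p integrable_on {a..b}"
  by (intro integrable_continuous_real p_continuous_sub)

lemma integral_p:
  assumes "a \<le> b" "b < 1"
  shows "integral {a..b} p = \<Phi> b - \<Phi> a"
proof -
  have neg: "integral {c..d} p = 0" if "d \<le> 0" for c d
    using that p_neg by (intro integral_unique has_integral_is_0) auto
  show ?thesis
  proof (cases "0 \<le> a")
    case True
    then show ?thesis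
      using Henstock_Kurzweil_Integration.integral_combine[of 0 a b p] assms p_integrable
      by (auto simp: \<Phi>_def)
  next
    case a: False
    show ?thesis
    proof (cases "0 \<le> b")
      case True
      then show ?thesis
        using Henstock_Kurzweil_Integration.integral_combine[of a 0 b p] assms p_integrable a neg[of 0 a] \<Phi>_neg[of a]
        by (auto simp: \<Phi>_def)
    next
      case False
      then show ?thesis using a neg \<Phi>_neg by auto
    qed
  qed
qed

lemma \<Phi>_diff_le:
  assumes "a \<le> b" "b < 1"
  shows "\<Phi> b - \<Phi> a \<le> (b - a) * p b"
proof -
  have "integral {a..b} p \<le> integral {a..b} (\<lambda>_. p b)"
    using assms by (intro integral_le p_integrable p_mono) auto
  then show ?thesis using assms by (simp add: integral_p)
qed

lemma \<Phi>_diff_ge: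
  assumes "a \<le> b" "b < 1"
  shows "(b - a) * p a \<le> \<Phi> b - \<Phi> a"
proof -
  have "integral {a..b} (\<lambda>_. p a) \<le> integral {a..b} p"
    using assms by (intro integral_le p_integrable p_mono) auto
  then show ?thesis using assms by (simp add: integral_p)
qed

lemma \<Phi>_mono: "\<lbrakk>a \<le> b; b < 1\<rbrakk> \<Longrightarrow> \<Phi> a \<le> \<Phi> b"
  using \<Phi>_diff_ge[of a b] p_nonneg[of a] mult_nonneg_nonneg[of "b - a" "p a"] by linarith

lemma \<Phi>_nonneg: "b < 1 \<Longrightarrow> 0 \<le> \<Phi> b"
  using \<Phi>_mono[of 0 b] \<Phi>_neg[of 0] \<Phi>_neg[of b] by (cases "b \<le> 0") auto

text \<open>
  Write \<open>y = rescale \<sigma> x\<close> with \<open>\<sigma> \<ge> 1\<close>. By the shifted equation, the difference of the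
  \<open>(m + 1)\<close>-st powers at \<open>y\<close> and \<open>x\<close> is the integral of \<open>L x\<close> against the nonnegative function
  \<open>p \<circ> rescale \<sigma> - p\<close>. Bounding the decreasing kernel by its left end value, of order
  \<open>y powr (1 - \<alpha>)\<close>, leaves a difference of integrals of \<open>p\<close>, of order \<open>(y - x) p y\<close>. Division by
  \<open>p y powr m\<close>, which is at least of order \<open>y powr (2 - \<alpha>)\<close>, gives the factor \<open>1 / y\<close>.
\<close>

lemma p_relative_lipschitz:
  assumes b: "b < 1"
  obtains C where "0 < C" "\<And>x y. \<lbrakk>0 < y; x \<le> y; y \<le> b\<rbrakk> \<Longrightarrow> p y - p x \<le> C * ((y - x) / y) * p y"
proof -
  obtain l where l: "0 < l"
    "\<And>z u. \<lbrakk>0 \<le> u; u \<le> z; z \<le> b\<rbrakk> \<Longrightarrow> L z u \<le> l * (z - u) powr (1 - \<alpha>)"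
    using L_upper[OF b] by blast
  obtain \<kappa> where \<kappa>: "0 < \<kappa>" "\<And>x. \<lbrakk>0 \<le> x; x \<le> b\<rbrakk> \<Longrightarrow> \<kappa> * x powr \<gamma> \<le> p x"
    using p_ge_power[OF b] by blast
  define C where "C = max 1 (l * (1 / (1 - b) + 1) / \<kappa> powr m)"
  have "p y - p x \<le> C * ((y - x) / y) * p y" if xy: "0 < y" "x \<le> y" "y \<le> b" for x y
  proof (cases "x \<le> 0")
    case True
    have "1 * 1 * p y \<le> C * ((y - x) / y) * p y"
      using xy True b by (intro mult_mono p_nonneg) (auto simp: C_def)
    then show ?thesis using True p_neg by simp
  next
    case False
    then have x: "0 < x" by simp
    define \<sigma> where "\<sigma> = (1 - x) / (1 - y)"
    define \<eta> where "\<eta> = y - x"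
    have \<sigma>: "1 \<le> \<sigma>" using xy b by (simp add: \<sigma>_def)
    have s\<eta>: "\<sigma> - 1 \<le> \<eta> / (1 - b)" 
    proof -
      have "\<sigma> - 1 = \<eta> / (1 - y)" using xy b by (simp add: \<sigma>_def \<eta>_def field_simps)
      also have "\<dots> \<le> \<eta> / (1 - b)" using xy b by (intro divide_left_mono) (auto simp: \<eta>_def)
      finally show ?thesis .
    qed
    have Tx: "rescale \<sigma> x = y" using xy b x by (simp add: rescale_def \<sigma>_def)
    have T0: "rescale \<sigma> (1 - \<sigma>) = 0" using \<sigma> by (simp add: rescale_def)
    have Tge: "u \<le> rescale \<sigma> u" if "u \<le> 1" for u
      using that \<sigma> mult_left_mono[of 1 \<sigma> "1 - u"] by (simp add: rescale_def field_simps)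
    have i1: "((\<lambda>u. L x u * p (rescale \<sigma> u)) has_integral p y powr (m + 1)) {1 - \<sigma>..x}"
      using p_rescale_eq[of \<sigma> x "1 - \<sigma>"] \<sigma> xy b x by (simp add: Tx T0)
    have i2: "((\<lambda>u. L x u * p u) has_integral p x powr (m + 1)) {1 - \<sigma>..x}"
      using \<sigma> xy b x by (intro p_eq_from) auto
    have j1: "((\<lambda>u. p (rescale \<sigma> u)) has_integral \<sigma> * \<Phi> y) {1 - \<sigma>..x}"
      using has_integral_rescale[of \<sigma> p "\<Phi> y" "1 - \<sigma>" x] \<sigma> b xy p_integrable[of y 0]
      by (simp add: Tx T0 \<Phi>_def has_integral_integral)
    have j2: "(p has_integral \<Phi> x) {1 - \<sigma>..x}"
      using integral_p[of "1 - \<sigma>" x] \<sigma> x xy b p_integrable[of x "1 - \<sigma>"] \<Phi>_neg[of "1 - \<sigma>"]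
      by (simp add: has_integral_iff)
    define l0 where "l0 = L x (1 - \<sigma>)"
    have l0: "l0 \<le> l * y powr (1 - \<alpha>)" "0 \<le> l0"
    proof -
      show "0 \<le> l0" unfolding l0_def using x xy b \<sigma> by (intro L_nonneg) auto
      then have "l0 \<le> \<sigma> * l0" using \<sigma> by (simp add: mult_le_cancel_right1)
      also have "\<dots> = L y 0"
        using L_rescale[of "1 - \<sigma>" x \<sigma>] \<sigma> x xy b by (simp add: Tx T0 l0_def)
      also have "\<dots> \<le> l * (y - 0) powr (1 - \<alpha>)" using xy by (intro l(2)) auto
      finally show "l0 \<le> l * y powr (1 - \<alpha>)" by simp
    qed
    have "p y powr (m + 1) - p x powr (m + 1) \<le> l0 * (\<sigma> * \<Phi> y - \<Phi> x)"
    proof (rule has_integral_le[OF has_integral_diff[OF i1 i2] has_integral_mult_right[OF has_integral_diff[OF j1 j2], of l0]])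
      fix u assume u: "u \<in> {1 - \<sigma>..x}"
      have "L x u * (p (rescale \<sigma> u) - p u) \<le> l0 * (p (rescale \<sigma> u) - p u)"
        unfolding l0_def using u x xy b \<sigma> p_mono[of u "rescale \<sigma> u"] Tge[of u]
        by (intro mult_right_mono L_antimono) auto
      then show "L x u * p (rescale \<sigma> u) - L x u * p u \<le> l0 * (p (rescale \<sigma> u) - p u)"
        by (simp add: algebra_simps)
    qed
    also have "\<sigma> * \<Phi> y - \<Phi> x = (\<sigma> - 1) * \<Phi> y + (\<Phi> y - \<Phi> x)" by (simp add: algebra_simps)
    also have "l0 * \<dots> \<le> l0 * (\<eta> / (1 - b) * p y + \<eta> * p y)"
    proof (intro mult_left_mono add_mono mult_mono)
      have "\<Phi> y \<le> y * p y" using \<Phi>_diff_le[of 0 y] xy b \<Phi>_neg[of 0] by simp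
      also have "\<dots> \<le> 1 * p y" using xy b by (intro mult_right_mono p_nonneg) auto
      finally show "\<Phi> y \<le> p y" by simp
      show "\<Phi> y - \<Phi> x \<le> \<eta> * p y" using \<Phi>_diff_le[of x y] xy b by (simp add: \<eta>_def)
    qed (use s\<eta> l0 xy b \<Phi>_nonneg in \<open>auto simp: \<eta>_def\<close>)
    also have "\<dots> \<le> l * y powr (1 - \<alpha>) * (\<eta> / (1 - b) * p y + \<eta> * p y)"
      using l0 xy b p_nonneg[of y] by (intro mult_right_mono) (auto simp: \<eta>_def)
    finally have A: "p y powr (m + 1) - p x powr (m + 1)
        \<le> l * (1 / (1 - b) + 1) * y powr (1 - \<alpha>) * \<eta> * p y" by (simp add: algebra_simps)
    have py: "0 < p y" using p_pos xy b by auto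
    have px: "0 < p x" using p_pos x xy b by auto
    have pxy: "p x \<le> p y" using p_mono xy b by auto
    \<comment> \<open>The elementary inequality \<open>(Y - X) Y\<^sup>m \<le> Y\<^sup>m\<^sup>+\<^sup>1 - X\<^sup>m\<^sup>+\<^sup>1\<close> for \<open>0 \<le> X \<le> Y\<close>.\<close>
    have "p x powr (m + 1) = p x * p x powr m" using px by (simp add: powr_add)
    also have "\<dots> \<le> p x * p y powr m"
      using px pxy m by (intro mult_left_mono powr_mono2) auto
    finally have B: "(p y - p x) * p y powr m \<le> p y powr (m + 1) - p x powr (m + 1)"
      using py by (simp add: powr_add algebra_simps)
    have "(p y - p x) * (\<kappa> powr m * y powr (2 - \<alpha>)) \<le> (p y - p x) * p y powr m"
    proof (rule mult_left_mono)
      have "\<kappa> powr m * y powr (2 - \<alpha>) = (\<kappa> * y powr \<gamma>) powr m"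
        using \<kappa>(1) by (subst powr_\<gamma>_powr_m) simp_all
      also have "\<dots> \<le> p y powr m" using \<kappa>(1) \<kappa>(2)[of y] xy m by (intro powr_mono2) auto
      finally show "\<kappa> powr m * y powr (2 - \<alpha>) \<le> p y powr m" .
    qed (use pxy in auto)
    also note B
    also note A
    also have "l * (1 / (1 - b) + 1) * y powr (1 - \<alpha>) * \<eta> * p y
        = (l * (1 / (1 - b) + 1) * (\<eta> / y) * p y) * y powr (2 - \<alpha>)"
      using xy powr_diff[of y "2 - \<alpha>" 1] by simp
    finally have "(p y - p x) * (\<kappa> powr m) * y powr (2 - \<alpha>)
        \<le> (l * (1 / (1 - b) + 1) * (\<eta> / y) * p y) * y powr (2 - \<alpha>)" by (simp only: mult.assoc)
    then have "(p y - p x) * \<kappa> powr m \<le> l * (1 / (1 - b) + 1) * (\<eta> / y) * p y"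
      by (rule mult_right_le_imp_le) (use xy in auto)
    then have "p y - p x \<le> (l * (1 / (1 - b) + 1) * (\<eta> / y) * p y) / \<kappa> powr m"
      using \<kappa>(1) by (simp only: pos_le_divide_eq powr_gt_zero)
    also have "\<dots> = l * (1 / (1 - b) + 1) / \<kappa> powr m * (\<eta> / y) * p y" by simp
    also have "\<dots> \<le> C * (\<eta> / y) * p y"
      using xy py by (intro mult_right_mono) (auto simp: C_def \<eta>_def)
    finally show ?thesis by (simp add: \<eta>_def)
  qed
  then show thesis using that[of C] by (auto simp: C_def)
qed

end

section \<open>Comparison of the scheme with shifted solutions\<close>

text \<open>
  The midpoint scheme in the variable in which the solution is increasing. For the index
  \<open>n = 2 q + k\<close> the nodes of weight \<open>2 h\<close> are \<open>k + 1, k + 3, \<dots>, n - 1\<close>, and the node \<open>k\<close> has the weight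
  \<open>h / 2\<close>.
\<close>

definition (in volterra_kernel) midpoint_recursion :: "real \<Rightarrow> real \<Rightarrow> (nat \<Rightarrow> real) \<Rightarrow> bool" where
  "midpoint_recursion X h V \<longleftrightarrow> V 0 = 0 \<and>
     (\<forall>q\<ge>1. \<forall>k\<in>{0, 1}. real (2 * q + k) * h \<le> X \<longrightarrow>
        0 \<le> V (2 * q + k) \<and>
        V (2 * q + k) powr (m + 1) =
          h / 2 * L (real (2 * q + k) * h) (real k * h) * V k
          + 2 * h * (\<Sum>i = 1..q. L (real (2 * q + k) * h) (real (2 * i + k - 1) * h) * V (2 * i + k - 1)))"

context volterra_solution
begin

lemma cell_bounds:
  assumes "a \<le> b" "b \<le> x" "x < 1"
  shows "L x b * (\<Phi> b - \<Phi> a) \<le> integral {a..b} (\<lambda>u. L x u * p u)"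
    and "integral {a..b} (\<lambda>u. L x u * p u) \<le> L x a * (\<Phi> b - \<Phi> a)"
proof -
  have p: "p integrable_on {a..b}" using assms by (intro p_integrable) auto
  have Lp: "(\<lambda>u. L x u * p u) integrable_on {a..b}" using assms by (intro Lp_integrable) auto
  have eq: "integral {a..b} (\<lambda>u. c * p u) = c * (\<Phi> b - \<Phi> a)" for c
    using assms by (simp add: integral_p)
  have "integral {a..b} (\<lambda>u. L x b * p u) \<le> integral {a..b} (\<lambda>u. L x u * p u)"
    using p Lp assms integrable_cmul[OF p, of "L x b"]
    by (intro integral_le mult_right_mono L_antimono p_nonneg) auto
  then show "L x b * (\<Phi> b - \<Phi> a) \<le> integral {a..b} (\<lambda>u. L x u * p u)" by (simp only: eq)
  have "integral {a..b} (\<lambda>u. L x u * p u) \<le> integral {a..b} (\<lambda>u. L x a * p u)"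
    using p Lp assms integrable_cmul[OF p, of "L x a"]
    by (intro integral_le mult_right_mono L_antimono p_nonneg) auto
  then show "integral {a..b} (\<lambda>u. L x u * p u) \<le> L x a * (\<Phi> b - \<Phi> a)" by (simp only: eq)
qed

lemma integral_Lp_split:
  assumes "a \<le> b" "b \<le> c" "c \<le> x" "x < 1"
  shows "integral {a..c} (\<lambda>u. L x u * p u)
    = integral {a..b} (\<lambda>u. L x u * p u) + integral {b..c} (\<lambda>u. L x u * p u)"
  using Henstock_Kurzweil_Integration.integral_combine[OF assms(1,2) Lp_integrable[OF assms(3,4)]] by simp

text \<open>
  Summation by parts against the decreasing weight \<open>L x\<close>: it suffices to dominate every partial sum
  by the integral of \<open>p\<close> up to the last node used. In the induction the current surplus
  \<open>\<Phi> (t k) - (\<Sum>l\<le>k. a l)\<close> is carried along with the weight at the current node.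
\<close>

lemma weighted_sum_le:
  assumes x: "0 \<le> x" "x < 1" and t: "\<And>i. i < n \<Longrightarrow> t i \<le> t (Suc i)" "t n \<le> x"
    and a: "\<And>i. i \<le> n \<Longrightarrow> (\<Sum>l\<le>i. a l) \<le> \<Phi> (t i)"
  shows "(\<Sum>i\<le>n. L x (t i) * a i) \<le> p x powr (m + 1)"
proof -
  define c where "c = min 0 (t 0)"
  let ?J = "\<lambda>s. integral {c..s} (\<lambda>u. L x u * p u)"
  have tj: "t j \<le> t i" if "j \<le> i" "i \<le> n" for i j
    using that
  proof (induction i rule: dec_induct)
    case (step k)
    then show ?case using t(1)[of k] by simp
  qed simp
  have tx: "t i \<le> x" if "i \<le> n" for i using tj[of i n] that t by auto
  have tc: "c \<le> t i" if "i \<le> n" for i using tj[of 0 i] that by (auto simp: c_def)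
  have main: "(\<Sum>i\<le>k. L x (t i) * a i) + L x (t k) * (\<Phi> (t k) - (\<Sum>l\<le>k. a l)) \<le> ?J (t k)"
    if "k \<le> n" for k
    using that
  proof (induction k)
    case 0
    have "L x (t 0) * (\<Phi> (t 0) - \<Phi> c) \<le> ?J (t 0)"
      using tx[of 0] tc[of 0] x by (intro cell_bounds) auto
    then show ?case by (simp add: \<Phi>_neg c_def algebra_simps)
  next
    case (Suc k)
    have "L x (t (Suc k)) * (\<Phi> (t k) - (\<Sum>l\<le>k. a l)) \<le> L x (t k) * (\<Phi> (t k) - (\<Sum>l\<le>k. a l))"
      using Suc.prems x tx[of "Suc k"] t(1)[of k] a[of k] by (intro mult_right_mono L_antimono) auto
    moreover have "L x (t (Suc k)) * (\<Phi> (t (Suc k)) - \<Phi> (t k))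
        \<le> integral {t k..t (Suc k)} (\<lambda>u. L x u * p u)"
      using Suc.prems x tx[of "Suc k"] t(1)[of k] by (intro cell_bounds) auto
    moreover have "?J (t (Suc k)) = ?J (t k) + integral {t k..t (Suc k)} (\<lambda>u. L x u * p u)"
      using Suc.prems x tx[of "Suc k"] t(1)[of k] tc[of k] by (intro integral_Lp_split) auto
    ultimately show ?case using Suc by (simp add: algebra_simps)
  qed
  have "(\<Sum>i\<le>n. L x (t i) * a i)
      \<le> (\<Sum>i\<le>n. L x (t i) * a i) + L x (t n) * (\<Phi> (t n) - (\<Sum>l\<le>n. a l))"
    using a[of n] t(2) x by (simp add: L_nonneg)
  also have "\<dots> \<le> ?J (t n)" using main[of n] by simp
  also have "\<dots> \<le> ?J x"
    using t(2) x
    by (intro integral_subset_le Lp_integrable) (auto intro!: mult_nonneg_nonneg L_nonneg p_nonneg)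
  also have "\<dots> = p x powr (m + 1)"
    using p_eq_from[of c x] x by (simp add: c_def integral_unique)
  finally show ?thesis .
qed

text \<open>
  The counterpart of the preceding lemma; here a partial sum must exceed the integral up to the
  next node, because the kernel on a cell is at most its value at the left end.
\<close>

lemma weighted_sum_ge:
  assumes x: "0 \<le> x" "x < 1" and t: "\<And>i. i \<le> n \<Longrightarrow> t i \<le> t (Suc i)" "t (Suc n) = x" "t 0 \<le> 0"
    and a: "\<And>i. i \<le> n \<Longrightarrow> \<Phi> (t (Suc i)) \<le> (\<Sum>l\<le>i. a l)"
  shows "p x powr (m + 1) \<le> (\<Sum>i\<le>n. L x (t i) * a i)"
proof -
  let ?J = "\<lambda>s. integral {t 0..s} (\<lambda>u. L x u * p u)"
  have tj: "t j \<le> t i" if "j \<le> i" "i \<le> Suc n" for i j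
    using that
  proof (induction i rule: dec_induct)
    case (step k)
    then show ?case using t(1)[of k] by simp
  qed simp
  have tx: "t i \<le> x" if "i \<le> Suc n" for i using tj[of i "Suc n"] that t by auto
  have main: "?J (t (Suc k)) \<le> (\<Sum>i\<le>k. L x (t i) * a i) - L x (t k) * ((\<Sum>l\<le>k. a l) - \<Phi> (t (Suc k)))"
    if "k \<le> n" for k
    using that
  proof (induction k)
    case 0
    have "?J (t (Suc 0)) \<le> L x (t 0) * (\<Phi> (t (Suc 0)) - \<Phi> (t 0))"
      using tx[of "Suc 0"] t(1)[of 0] x by (intro cell_bounds) auto
    then show ?case using t by (simp add: \<Phi>_neg algebra_simps)
  next
    case (Suc k)
    have "L x (t (Suc k)) * ((\<Sum>l\<le>k. a l) - \<Phi> (t (Suc k))) \<le> L x (t k) * ((\<Sum>l\<le>k. a l) - \<Phi> (t (Suc k)))"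
      using Suc.prems x tx[of "Suc k"] t(1)[of k] a[of k] by (intro mult_right_mono L_antimono) auto
    moreover have "integral {t (Suc k)..t (Suc (Suc k))} (\<lambda>u. L x u * p u)
        \<le> L x (t (Suc k)) * (\<Phi> (t (Suc (Suc k))) - \<Phi> (t (Suc k)))"
      using Suc.prems x tx[of "Suc (Suc k)"] t(1)[of "Suc k"] by (intro cell_bounds) auto
    moreover have "?J (t (Suc (Suc k)))
        = ?J (t (Suc k)) + integral {t (Suc k)..t (Suc (Suc k))} (\<lambda>u. L x u * p u)"
      using Suc.prems x tx[of "Suc (Suc k)"] t(1)[of "Suc k"] tj[of 0 "Suc k"]
      by (intro integral_Lp_split) auto
    ultimately show ?case using Suc by (simp add: algebra_simps)
  qed
  have "p x powr (m + 1) = ?J (t (Suc n))"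
    using p_eq_from[of "t 0" x] x t by (simp add: integral_unique)
  also have "\<dots> \<le> (\<Sum>i\<le>n. L x (t i) * a i) - L x (t n) * ((\<Sum>l\<le>n. a l) - \<Phi> (t (Suc n)))"
    using main[of n] by simp
  also have "\<dots> \<le> (\<Sum>i\<le>n. L x (t i) * a i)"
    using a[of n] tx[of n] x by (simp add: L_nonneg)
  finally show ?thesis .
qed

text \<open>
  Induction over the grid. The value \<open>p (x n)\<close> satisfies the integral equation at \<open>x n\<close>; the nodes
  seen from there are \<open>rescale (1 + s n) (j h)\<close>, and homogeneity of the kernel turns the quadrature
  at \<open>n h\<close> into one at \<open>x n\<close>. The required bounds for the partial sums follow from the condition
  \<open>step\<close>, which relates neighbouring nodes of one parity and does not involve \<open>n\<close>; this is where
  the shifts must increase with the index.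
\<close>

lemma midpoint_le_shifted:
  fixes s :: "nat \<Rightarrow> real"
  assumes V: "midpoint_recursion X h V" and h: "0 < h" and X: "X < 1"
    and s: "\<And>j. 0 \<le> s j" "\<And>i j. i \<le> j \<Longrightarrow> s i \<le> s j"
    and x: "\<And>j. x j = rescale (1 + s j) (real j * h)"
    and first: "h \<le> X \<Longrightarrow> V 1 \<le> p (x 1)"
    and start: "\<And>j. real j * h \<le> X \<Longrightarrow> 3 * h * p (x j) \<le> (1 + s j) * \<Phi> (x j)"
    and step: "\<And>j. real (j + 2) * h \<le> X \<Longrightarrow>
      (1 + s j) * \<Phi> (x j) + 2 * h * p (x (j + 2)) \<le> (1 + s (j + 2)) * \<Phi> (x (j + 2))"
  shows "real n * h \<le> X \<Longrightarrow> V n \<le> p (x n)"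
proof (induction n rule: less_induct)
  case (less n)
  have xl: "x j < 1" if "real j * h \<le> X" for j using that X s[of j] by (simp add: x add_pos_nonneg)
  consider "n = 0" | "n = 1" | "2 \<le> n" by linarith
  then show ?case
  proof cases
    case 1
    then show ?thesis using V p_nonneg[OF xl[OF less.prems]] by (simp add: midpoint_recursion_def)
  next
    case 2
    then show ?thesis using first less.prems by simp
  next
    case 3
    define q where "q = n div 2"
    define k where "k = n mod 2"
    have n: "n = 2 * q + k" and k: "k \<in> {0, 1}" and q: "1 \<le> q"
      using 3 by (auto simp: q_def k_def)
    have nX: "real (2 * q + k) * h \<le> X" using less.prems by (simp only: n[symmetric])
    note rec = V[unfolded midpoint_recursion_def, THEN conjunct2, rule_format, OF q k nX, folded n]
    define \<nu> where "\<nu> i = (if i = 0 then k else 2 * i + k - 1)" for i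
    define c where "c i = (if i = 0 then h / 2 else 2 * h)" for i :: nat
    define \<sigma> where "\<sigma> = 1 + s n"
    have \<sigma>: "0 < \<sigma>" using s(1)[of n] by (simp add: \<sigma>_def)
    define t where "t i = rescale \<sigma> (real (\<nu> i) * h)" for i
    define a where "a i = c i * V (\<nu> i) / \<sigma>" for i
    have \<nu>_less: "\<nu> i < n" if "i \<le> q" for i using that n q k by (auto simp: \<nu>_def)
    have jX: "real j * h \<le> X" if "j \<le> n" for j
    proof -
      have "real j * h \<le> real n * h" using that h by (intro mult_right_mono) auto
      then show ?thesis using less.prems by simp
    qed
    have nh1: "real n * h < 1" using less.prems X by simp
    have \<nu>_mono: "\<nu> i \<le> \<nu> (Suc i)" for i using k by (auto simp: \<nu>_def)
    have IH: "V (\<nu> i) \<le> p (x (\<nu> i))" if "i \<le> q" for i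
      using less.IH[of "\<nu> i"] \<nu>_less[OF that] jX[of "\<nu> i"] by simp
    have xn: "x n = rescale \<sigma> (real n * h)" by (simp add: x \<sigma>_def)
    have xn0: "0 \<le> x n"
    proof -
      have "1 - real n * h \<le> 1" using h by simp
      also have "1 \<le> 1 * \<sigma>" using s(1)[of n] by (simp add: \<sigma>_def)
      finally have "1 - real n * h \<le> 1 * \<sigma>" .
      then show ?thesis using \<sigma> by (simp add: xn rescale_def divide_le_eq)
    qed
    have partial: "(\<Sum>l\<le>i. c l * V (\<nu> l)) \<le> (1 + s (\<nu> i)) * \<Phi> (x (\<nu> i))" if "i \<le> q" for i
      using that
    proof (induction i)
      case 0
      have "h / 2 * V (\<nu> 0) \<le> h / 2 * p (x (\<nu> 0))"
        using IH[of 0] h by (intro mult_left_mono) auto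
      also have "\<dots> \<le> 3 * h * p (x (\<nu> 0))"
        using h p_nonneg[OF xl[OF jX[of "\<nu> 0"]]] \<nu>_less[of 0] by (intro mult_right_mono) auto
      also have "\<dots> \<le> (1 + s (\<nu> 0)) * \<Phi> (x (\<nu> 0))" using jX[of "\<nu> 0"] \<nu>_less[of 0] by (intro start) auto
      finally show ?case by (simp add: c_def)
    next
      case (Suc i)
      have \<nu>n: "\<nu> (Suc i) \<le> n" using \<nu>_less[OF Suc.prems] by simp
      have new: "2 * h * V (\<nu> (Suc i)) \<le> 2 * h * p (x (\<nu> (Suc i)))"
        using IH[OF Suc.prems] h by (intro mult_left_mono) auto
      show ?case
      proof (cases "i = 0")
        case True
        have "x k \<le> rescale (1 + s (k + 1)) (real k * h)"
          unfolding x using s(1)[of k] s(2)[of k "k + 1"] jX[of k] X \<nu>n True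
          by (intro rescale_mono_factor) (auto simp: \<nu>_def add_pos_nonneg)
        also have "\<dots> \<le> x (k + 1)" unfolding x using h s(1)[of "k + 1"] by (simp add: add_pos_nonneg)
        finally have "p (x k) \<le> p (x (\<nu> (Suc i)))"
          using True xl[OF jX[OF \<nu>n]] by (intro p_mono) (auto simp: \<nu>_def)
        then have "h / 2 * V k \<le> h / 2 * p (x (\<nu> (Suc i)))"
          using IH[of 0] h by (intro mult_left_mono) (auto simp: \<nu>_def)
        also have "\<dots> \<le> h * p (x (\<nu> (Suc i)))"
          using h p_nonneg[OF xl[OF jX[OF \<nu>n]]] by (intro mult_right_mono) auto
        finally have "h / 2 * V k \<le> h * p (x (\<nu> (Suc i)))" .
        then have "(\<Sum>l\<le>Suc i. c l * V (\<nu> l)) \<le> 3 * h * p (x (\<nu> (Suc i)))"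
          using True new by (simp add: c_def \<nu>_def)
        also have "\<dots> \<le> (1 + s (\<nu> (Suc i))) * \<Phi> (x (\<nu> (Suc i)))" using jX[OF \<nu>n] by (intro start)
        finally show ?thesis .
      next
        case False
        then have "\<nu> (Suc i) = \<nu> i + 2" by (auto simp: \<nu>_def)
        then have "(1 + s (\<nu> i)) * \<Phi> (x (\<nu> i)) + 2 * h * p (x (\<nu> (Suc i)))
            \<le> (1 + s (\<nu> (Suc i))) * \<Phi> (x (\<nu> (Suc i)))"
          using step[of "\<nu> i"] jX[OF \<nu>n] by simp
        then show ?thesis using Suc new by (simp add: c_def)
      qed
    qed
    have "V n powr (m + 1) = (\<Sum>i\<le>q. L (real n * h) (real (\<nu> i) * h) * (c i * V (\<nu> i)))"
    proof -
      have "(\<Sum>i\<le>q. L (real n * h) (real (\<nu> i) * h) * (c i * V (\<nu> i))) =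
        L (real n * h) (real (\<nu> 0) * h) * (c 0 * V (\<nu> 0)) +
        (\<Sum>i = 1..q. L (real n * h) (real (\<nu> i) * h) * (c i * V (\<nu> i)))"
        by (simp add: atMost_atLeast0 sum.atLeast_Suc_atMost)
      also have "(\<Sum>i = 1..q. L (real n * h) (real (\<nu> i) * h) * (c i * V (\<nu> i)))
         = 2 * h * (\<Sum>i = 1..q. L (real n * h) (real (2 * i + k - 1) * h) * V (2 * i + k - 1))"
        by (auto simp: sum_distrib_left \<nu>_def c_def intro!: sum.cong)
      finally show ?thesis using rec by (simp add: \<nu>_def c_def)
    qed
    also have "\<dots> = (\<Sum>i\<le>q. L (x n) (t i) * a i)"
    proof (rule sum.cong)
      fix i assume "i \<in> {..q}"
      then have "real (\<nu> i) * h \<le> real n * h" using \<nu>_less[of i] h by (intro mult_right_mono) auto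
      then show "L (real n * h) (real (\<nu> i) * h) * (c i * V (\<nu> i)) = L (x n) (t i) * a i"
        using \<sigma> nh1 by (simp add: t_def a_def xn L_rescale)
    qed auto
    also have "\<dots> \<le> p (x n) powr (m + 1)"
    proof (rule weighted_sum_le)
      show "t i \<le> t (Suc i)" for i unfolding t_def using \<sigma> \<nu>_mono[of i] h by simp
      show "t q \<le> x n" unfolding t_def xn using \<sigma> \<nu>_less[of q] h by simp
      fix i assume i: "i \<le> q"
      define j where "j = \<nu> i"
      have j: "j \<le> n" using \<nu>_less[OF i] by (simp add: j_def)
      have xt: "x j \<le> t i" unfolding x t_def \<sigma>_def j_def[symmetric]
        using s(1)[of j] s(2)[OF j] jX[OF j] X by (intro rescale_mono_factor) (auto simp: add_pos_nonneg)
      have t1: "t i < 1" using \<sigma> jX[OF j] X by (simp add: t_def j_def)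
      have "(\<Sum>l\<le>i. c l * V (\<nu> l)) \<le> (1 + s j) * \<Phi> (x j)" using partial[OF i] by (simp add: j_def)
      \<comment> \<open>Passing from the shift of node j to the larger shift of node n only enlarges the integral.\<close>
      also have "\<dots> \<le> \<sigma> * \<Phi> (t i)"
        using s(1)[of j] s(2)[OF j] xt t1 by (intro mult_mono \<Phi>_mono \<Phi>_nonneg) (auto simp: \<sigma>_def)
      finally show "(\<Sum>l\<le>i. a l) \<le> \<Phi> (t i)"
        using \<sigma> by (simp add: a_def sum_divide_distrib[symmetric] divide_le_eq mult.commute)
    qed (use xn0 xl less.prems in auto)
    finally have le: "V n powr (m + 1) \<le> p (x n) powr (m + 1)" .
    show ?thesis
      by (rule powr_le_cancel[OF le])
        (use rec less.prems m p_nonneg xl in auto)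
  qed
qed

text \<open>
  The same argument for shifts to the right. Cells are now attached to their left end points, so the
  first cell \<open>[0, (k + 1) h]\<close> stays uncovered; the condition \<open>offset\<close> says that the shifted solution
  vanishes there. The last cell has length \<open>h\<close> instead of \<open>2 h\<close>, which is why \<open>start\<close> and \<open>step\<close> are
  needed for both distances.
\<close>

lemma shifted_le_midpoint:
  fixes s :: "nat \<Rightarrow> real"
  assumes V: "midpoint_recursion X h V" and h: "0 < h" and X: "X < 1"
    and s: "\<And>j. 0 \<le> s j" "\<And>i j. i \<le> j \<Longrightarrow> s i \<le> s j" "\<And>j. real j * h \<le> X \<Longrightarrow> s j < 1"
    and sle: "\<And>j. s j \<le> real j * h"
    and x: "\<And>j. x j = rescale (1 - s j) (real j * h)"
    and first: "h \<le> X \<Longrightarrow> p (x 1) \<le> V 1" "0 \<le> V 1"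
    and offset: "\<And>n. 2 \<le> n \<Longrightarrow> real (n mod 2 + 1) * h \<le> s n"
    and start: "\<And>j J. \<lbrakk>j \<in> {1, 2}; J \<in> {j + 1, j + 2}; real J * h \<le> X\<rbrakk> \<Longrightarrow>
      (1 - s J) * \<Phi> (x J) \<le> 2 * h * p (x j)"
    and step: "\<And>j J. \<lbrakk>1 \<le> j; J \<in> {j + 1, j + 2}; real J * h \<le> X\<rbrakk> \<Longrightarrow>
      (1 - s J) * \<Phi> (x J) \<le> (1 - s j) * \<Phi> (x j) + 2 * h * p (x j)"
  shows "real n * h \<le> X \<Longrightarrow> p (x n) \<le> V n"
proof (induction n rule: less_induct)
  case (less n)
  have xl: "x j < 1" if "real j * h \<le> X" for j using that X s(3)[of j] by (simp add: x)
  consider "n = 0" | "n = 1" | "2 \<le> n" by linarith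
  then show ?case
  proof cases
    case 1
    then have "x n = 0" using s(1)[of 0] sle[of 0] by (simp add: x rescale_def)
    then show ?thesis using V 1 by (simp add: midpoint_recursion_def p_neg)
  next
    case 2
    then show ?thesis using first less.prems by simp
  next
    case 3
    define q where "q = n div 2 - 1"
    define k where "k = n mod 2"
    have n: "n = 2 * Suc q + k" and k: "k \<in> {0, 1}"
      using 3 by (auto simp: q_def k_def)
    define \<nu> where "\<nu> i = (if i \<le> q then 2 * i + k + 1 else n)" for i
    define \<sigma> where "\<sigma> = 1 - s n"
    have \<sigma>: "0 < \<sigma>" using s(3)[of n] less.prems by (simp add: \<sigma>_def)
    define t where "t i = rescale \<sigma> (real (\<nu> i) * h)" for i
    define a where "a i = 2 * h * V (\<nu> i) / \<sigma>" for i
    have \<nu>_le: "\<nu> i \<le> n" for i using n by (auto simp: \<nu>_def)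
    have \<nu>_less: "\<nu> i < n" if "i \<le> q" for i using that n by (auto simp: \<nu>_def)
    have jX: "real j * h \<le> X" if "j \<le> n" for j
    proof -
      have "real j * h \<le> real n * h" using that h by (intro mult_right_mono) auto
      then show ?thesis using less.prems by simp
    qed
    have nh1: "real n * h < 1" using less.prems X by simp
    have \<nu>_mono: "\<nu> i \<le> \<nu> (Suc i)" for i using n by (auto simp: \<nu>_def)
    have \<nu>_Suc: "\<nu> (Suc i) \<in> {\<nu> i + 1, \<nu> i + 2}" if "i \<le> q" for i
      using that n by (cases "i = q") (auto simp: \<nu>_def)
    have IH: "p (x (\<nu> i)) \<le> V (\<nu> i)" if "i \<le> q" for i
      using less.IH[of "\<nu> i"] \<nu>_less[OF that] jX[of "\<nu> i"] by simp
    have q1: "1 \<le> Suc q" by simp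
    have nX: "real (2 * Suc q + k) * h \<le> X" using less.prems by (simp only: n[symmetric])
    note rec = V[unfolded midpoint_recursion_def, THEN conjunct2, rule_format, OF q1 k nX, folded n]
    have xn: "x n = rescale \<sigma> (real n * h)" by (simp add: x \<sigma>_def)
    have xn0: "0 \<le> x n" using \<sigma> sle[of n] by (simp add: xn \<sigma>_def rescale_def divide_le_eq)
    have partial: "(1 - s (\<nu> (Suc i))) * \<Phi> (x (\<nu> (Suc i))) \<le> (\<Sum>l\<le>i. 2 * h * V (\<nu> l))" if "i \<le> q" for i
      using that
    proof (induction i)
      case 0
      have "(1 - s (\<nu> (Suc 0))) * \<Phi> (x (\<nu> (Suc 0))) \<le> 2 * h * p (x (\<nu> 0))"
        using \<nu>_Suc[of 0] jX[OF \<nu>_le] k by (intro start) (auto simp: \<nu>_def)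
      also have "\<dots> \<le> 2 * h * V (\<nu> 0)" using IH[of 0] h by (intro mult_left_mono) auto
      finally show ?case by simp
    next
      case (Suc i)
      have "(1 - s (\<nu> (Suc (Suc i)))) * \<Phi> (x (\<nu> (Suc (Suc i))))
         \<le> (1 - s (\<nu> (Suc i))) * \<Phi> (x (\<nu> (Suc i))) + 2 * h * p (x (\<nu> (Suc i)))"
        using \<nu>_Suc[OF Suc.prems] jX[OF \<nu>_le] Suc.prems by (intro step) (auto simp: \<nu>_def)
      also have "2 * h * p (x (\<nu> (Suc i))) \<le> 2 * h * V (\<nu> (Suc i))"
        using IH[OF Suc.prems] h by (intro mult_left_mono) auto
      finally show ?case using Suc by simp
    qed
    have "p (x n) powr (m + 1) \<le> (\<Sum>i\<le>q. L (x n) (t i) * a i)"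
    proof (rule weighted_sum_ge)
      show "t i \<le> t (Suc i)" for i unfolding t_def using \<sigma> \<nu>_mono[of i] h by simp
      show "t (Suc q) = x n" by (simp add: t_def xn \<nu>_def)
      have "real (\<nu> 0) * h \<le> s n" using offset[OF 3] by (simp add: \<nu>_def k_def)
      then show "t 0 \<le> 0" using \<sigma> by (simp add: t_def rescale_def \<sigma>_def le_divide_eq)
      fix i assume i: "i \<le> q"
      define j where "j = \<nu> (Suc i)"
      have j: "j \<le> n" using \<nu>_le by (simp add: j_def)
      have tx: "t (Suc i) \<le> x j" unfolding x t_def j_def[symmetric]
        using s(2)[OF j] jX[OF j] X \<sigma> by (intro rescale_mono_factor) (auto simp: \<sigma>_def)
      have t1: "t (Suc i) < 1" using \<sigma> jX[OF j] X by (simp add: t_def j_def)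
      have "\<sigma> * \<Phi> (t (Suc i)) \<le> (1 - s j) * \<Phi> (x j)"
        using s(2)[OF j] s(3)[OF jX[OF j]] tx t1 xl[OF jX[OF j]]
        by (intro mult_mono \<Phi>_mono \<Phi>_nonneg) (auto simp: \<sigma>_def)
      also have "\<dots> \<le> (\<Sum>l\<le>i. 2 * h * V (\<nu> l))" using partial[OF i] by (simp add: j_def)
      finally show "\<Phi> (t (Suc i)) \<le> (\<Sum>l\<le>i. a l)"
        using \<sigma> by (simp add: a_def sum_divide_distrib[symmetric] le_divide_eq mult.commute)
    qed (use xn0 xl less.prems in auto)
    also have "\<dots> = (\<Sum>i\<le>q. L (real n * h) (real (\<nu> i) * h) * (2 * h * V (\<nu> i)))"
    proof (rule sum.cong)
      fix i assume "i \<in> {..q}"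
      then have "real (\<nu> i) * h \<le> real n * h" using \<nu>_less[of i] h by (intro mult_right_mono) auto
      then show "L (x n) (t i) * a i = L (real n * h) (real (\<nu> i) * h) * (2 * h * V (\<nu> i))"
        using \<sigma> nh1 by (simp add: t_def a_def xn L_rescale)
    qed auto
    also have "\<dots> = 2 * h * (\<Sum>i = 1..Suc q. L (real n * h) (real (2 * i + k - 1) * h) * V (2 * i + k - 1))"
    proof -
      have "(\<Sum>i = 1..Suc q. L (real n * h) (real (2 * i + k - 1) * h) * V (2 * i + k - 1))
        = (\<Sum>i\<le>q. L (real n * h) (real (\<nu> i) * h) * V (\<nu> i))"
        by (simp only: One_nat_def sum.shift_bounds_cl_Suc_ivl atMost_atLeast0[symmetric])
          (auto simp: \<nu>_def intro!: sum.cong)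
      then show ?thesis by (simp add: sum_distrib_left algebra_simps)
    qed
    also have "\<dots> \<le> V n powr (m + 1)"
    proof -
      have "V k \<ge> 0" using V k first by (auto simp: midpoint_recursion_def)
      moreover have "0 \<le> L (real n * h) (real k * h)"
        using nh1 n h by (intro L_nonneg mult_right_mono) auto
      ultimately have "0 \<le> h / 2 * L (real n * h) (real k * h) * V k" using h by simp
      moreover have "V n powr (m + 1) = h / 2 * L (real n * h) (real k * h) * V k
        + 2 * h * (\<Sum>i = 1..Suc q. L (real n * h) (real (2 * i + k - 1) * h) * V (2 * i + k - 1))"
        using rec by simp
      ultimately show ?thesis by linarith
    qed
    finally have le: "p (x n) powr (m + 1) \<le> V n powr (m + 1)" .
    have "0 \<le> V n" using rec by simp
    then show ?thesis
      using powr_le_cancel[OF le] m p_nonneg xl less.prems by auto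
  qed
qed

section \<open>Two-sided bounds for the computed values\<close>

text \<open>
  The shifts are \<open>s j = M h (j + 1) powr \<theta>\<close>, at most of order \<open>h powr (1 - \<theta>)\<close> on the grid. For the
  condition on neighbouring nodes, \<open>x (j + 2) - x j\<close> exceeds \<open>2 h\<close> by about \<open>s (j + 2) - s j\<close>, which
  is at least of order \<open>M h / j\<close>; the relative change of \<open>p\<close> between the two points is of order
  \<open>h / (j h) = 1 / j\<close>, so a large \<open>M\<close> suffices. When \<open>M\<close> makes the increments of \<open>s\<close> too long for this
  local estimate (small \<open>j\<close>), they are so long that the doubling property alone suffices.
\<close>

lemma midpoint_upper_bound:
  assumes X: "0 < X" "X < 1" and \<theta>: "0 < \<theta>" "\<theta> < 1" and c: "0 < c"
  obtains M h0 where "0 < M" "0 < h0"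
    "\<And>h V n. \<lbrakk>0 < h; h \<le> h0; midpoint_recursion X h V; V 1 \<le> c * h powr \<gamma>; real n * h \<le> X\<rbrakk> \<Longrightarrow>
      \<exists>s. 0 \<le> s \<and> s \<le> 1 \<and> s \<le> M * h powr (1 - \<theta>) \<and> V n \<le> p (rescale (1 + s) (real n * h))"
proof -
  define \<omega> where "\<omega> = (1 - X) / 2"
  have \<omega>: "0 < \<omega>" using X by (simp add: \<omega>_def)
  then have b: "1 - \<omega> < 1" by simp
  obtain C where C: "0 < C" "\<And>x y. \<lbrakk>0 < y; x \<le> y; y \<le> 1 - \<omega>\<rbrakk> \<Longrightarrow> p y - p x \<le> C * ((y - x) / y) * p y"
    using p_relative_lipschitz[OF b] by metis
  obtain C' where C': "1 \<le> C'"
      "\<And>x y. \<lbrakk>0 \<le> y; y \<le> 8 * x; x \<le> 1 - \<omega>; y \<le> 1 - \<omega>\<rbrakk> \<Longrightarrow> p y \<le> C' * p x"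
    using p_doubling[OF b, of 8] by (metis zero_less_numeral)
  obtain \<kappa> where \<kappa>: "0 < \<kappa>" "\<And>x. \<lbrakk>0 \<le> x; x \<le> 1 - \<omega>\<rbrakk> \<Longrightarrow> \<kappa> * x powr \<gamma> \<le> p x"
    using p_ge_power[OF b] by metis
  define d0 where "d0 = 2 * C' / \<omega>"
  have d0: "0 < d0" using C' \<omega> by (simp add: d0_def)
  \<comment> \<open>The three entries serve the first cells, the local estimate and the starting value.\<close>
  define M where "M = Max {12 * C', C * (2 + d0) * (2 + d0 * \<omega>) / (\<theta> * \<omega>), 2 * (c / \<kappa>) powr (1 / \<gamma>)}"
  have M: "12 * C' \<le> M" "C * (2 + d0) * (2 + d0 * \<omega>) / (\<theta> * \<omega>) \<le> M" "2 * (c / \<kappa>) powr (1 / \<gamma>) \<le> M"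
    by (auto simp: M_def)
  have M12: "12 \<le> M" using M(1) C'(1) by simp
  define h0 where "h0 = min X ((1 / (2 * M)) powr (1 / (1 - \<theta>)))"
  have h0: "0 < h0" using X M12 by (simp add: h0_def)
  show thesis
  proof (rule that[of "2 * M" h0])
    show "0 < 2 * M" "0 < h0" using M12 h0 by auto
    fix h V n
    assume h: "0 < h" "h \<le> h0" and V: "midpoint_recursion X h V" "V 1 \<le> c * h powr \<gamma>"
      and n: "real n * h \<le> X"
    have hX: "h \<le> X" using h by (simp add: h0_def)
    define s where "s j = M * h * (real j + 1) powr \<theta>" for j
    define x where "x j = rescale (1 + s j) (real j * h)" for j
    have s0: "0 \<le> s j" for j using M12 h by (simp add: s_def)
    have smono: "s i \<le> s j" if "i \<le> j" for i j
      unfolding s_def using that \<theta> M12 h by (intro mult_left_mono powr_mono2) auto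
    have small: "2 * M * h powr (1 - \<theta>) \<le> 1"
    proof -
      have "h powr (1 - \<theta>) \<le> ((1 / (2 * M)) powr (1 / (1 - \<theta>))) powr (1 - \<theta>)"
        using h \<theta> by (intro powr_mono2) (auto simp: h0_def)
      also have "\<dots> = 1 / (2 * M)" using \<theta> M12 by (simp add: powr_powr)
      finally show ?thesis using M12 by (simp add: field_simps)
    qed
    have s_le: "s j \<le> 2 * M * h powr (1 - \<theta>)" if "real j * h \<le> X" for j
    proof -
      have "(real j + 1) * h \<le> 2" using that hX X by (simp add: algebra_simps)
      then have "(real j + 1) powr \<theta> \<le> (2 / h) powr \<theta>"
        using h \<theta> by (intro powr_mono2) (auto simp: field_simps)
      also have "\<dots> = 2 powr \<theta> * h powr - \<theta>" using h by (simp add: powr_divide powr_minus_divide)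
      also have "\<dots> \<le> 2 powr 1 * h powr - \<theta>" using \<theta> by (intro mult_right_mono powr_mono) auto
      finally have "s j \<le> M * h * (2 * h powr - \<theta>)"
        unfolding s_def using M12 h by (intro mult_left_mono) auto
      also have "\<dots> = 2 * M * h powr (1 - \<theta>)"
        using h powr_add[of h 1 "- \<theta>"] by simp
      finally show ?thesis .
    qed
    have s1: "s j \<le> 1" if "real j * h \<le> X" for j using s_le[OF that] small by simp
    have sx: "(1 + s j) * x j = s j + real j * h" for j
      unfolding x_def using s0[of j] by (subst rescale_mult) auto
    have s_ge: "M * h \<le> s j" for j
    proof -
      have "M * h * 1 \<le> s j" unfolding s_def
        using M12 h \<theta> by (intro mult_left_mono ge_one_powr_ge_zero) auto
      then show ?thesis by simp
    qed
    have jh0: "0 \<le> real j * h" for j using h by simp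
    have x0: "0 \<le> x j" for j
    proof -
      have "0 \<le> (1 + s j) * x j" unfolding sx using s0 jh0 by (intro add_nonneg_nonneg)
      then show ?thesis using s0[of j] by (simp add: zero_le_mult_iff)
    qed
    have xb: "x j \<le> 1 - \<omega>" if "real j * h \<le> X" for j
    proof -
      have "(1 - X) / 2 \<le> (1 - real j * h) / (1 + s j)"
        using s0[of j] s1[OF that] that X by (intro frac_le) auto
      then show ?thesis by (simp add: x_def rescale_def \<omega>_def)
    qed
    have xlow: "(s j + real j * h) / 2 \<le> x j" if "real j * h \<le> X" for j
    proof -
      have "(1 + s j) * x j \<le> 2 * x j" using s1[OF that] x0 by (intro mult_right_mono) auto
      then show ?thesis by (simp add: sx)
    qed
    have xup: "x j \<le> s j + real j * h" for j
      using mult_right_mono[of 1 "1 + s j" "x j"] s0[of j] x0[of j] by (simp add: sx)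
    have p0: "0 \<le> p (x j)" if "real j * h \<le> X" for j using xb[OF that] \<omega> by (intro p_nonneg) auto
    have "V n \<le> p (x n)"
    proof (rule midpoint_le_shifted[OF V(1) h(1) X(2) s0 smono x_def _ _ _ n])
      assume hX': "h \<le> X"
      have "V 1 \<le> \<kappa> * ((c / \<kappa>) powr (1 / \<gamma>) * h) powr \<gamma>"
        using V(2) c \<kappa>(1) \<gamma>_pos h by (simp add: powr_mult powr_powr)
      also have "\<dots> \<le> \<kappa> * x 1 powr \<gamma>"
      proof (intro mult_left_mono powr_mono2)
        have "(c / \<kappa>) powr (1 / \<gamma>) * h \<le> M / 2 * h" using M(3) h by (intro mult_right_mono) auto
        also have "\<dots> \<le> (s 1 + real 1 * h) / 2" using s_ge[of 1] h by simp
        also have "\<dots> \<le> x 1" using hX' by (intro xlow) simp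
        finally show "(c / \<kappa>) powr (1 / \<gamma>) * h \<le> x 1" .
      qed (use \<kappa> \<gamma>_pos h in auto)
      also have "\<dots> \<le> p (x 1)" using x0 xb[of 1] hX' by (intro \<kappa>) auto
      finally show "V 1 \<le> p (x 1)" .
    next
      fix j assume j: "real j * h \<le> X"
      have "p (x j) \<le> C' * p (x j / 2)" using x0[of j] xb[OF j] by (intro C') auto
      then have "3 * h * p (x j) \<le> 3 * h * (C' * p (x j / 2))" using h by (intro mult_left_mono) auto
      also have "\<dots> = 3 * C' * h * p (x j / 2)" by simp
      also have "\<dots> \<le> (x j / 2) * p (x j / 2)"
      proof (rule mult_right_mono)
        have "12 * C' * h \<le> s j + real j * h"
          using mult_right_mono[OF M(1), of h] h s_ge[of j] jh0[of j] by linarith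
        then show "3 * C' * h \<le> x j / 2" using xlow[OF j] by simp
        show "0 \<le> p (x j / 2)" using x0[of j] xb[OF j] \<omega> by (intro p_nonneg) auto
      qed
      also have "\<dots> \<le> \<Phi> (x j) - \<Phi> (x j / 2)"
        using \<Phi>_diff_ge[of "x j / 2" "x j"] x0[of j] xb[OF j] \<omega> by simp
      also have "\<dots> \<le> \<Phi> (x j)" using \<Phi>_nonneg[of "x j / 2"] x0[of j] xb[OF j] \<omega> by simp
      also have "\<dots> \<le> (1 + s j) * \<Phi> (x j)"
        using s0[of j] \<Phi>_nonneg[of "x j"] xb[OF j] \<omega> by (simp add: algebra_simps)
      finally show "3 * h * p (x j) \<le> (1 + s j) * \<Phi> (x j)" .
    next
      fix j assume J: "real (j + 2) * h \<le> X"
      define \<eta> where "\<eta> = x (j + 2) - x j"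
      define d where "d = M * ((real j + 3) powr \<theta> - (real j + 1) powr \<theta>)"
      have j: "real j * h \<le> X" using J h by (simp add: algebra_simps)
      have \<delta>: "s (j + 2) - s j = h * d" by (simp add: s_def d_def algebra_simps)
      have d_ge: "2 * M * \<theta> / (real j + 3) \<le> d"
      proof -
        have "1 / (real j + 3) \<le> (real j + 3) powr (\<theta> - 1)"
          using powr_mono[of "-1" "\<theta> - 1" "real j + 3"] \<theta> by (simp add: powr_minus_divide)
        then have "\<theta> * (1 / (real j + 3)) * 2 \<le> \<theta> * (real j + 3) powr (\<theta> - 1) * 2"
          using \<theta> by (intro mult_right_mono mult_left_mono) auto
        also have "\<dots> \<le> (real j + 3) powr \<theta> - (real j + 1) powr \<theta>"
          using powr_increment_ge[of "real j + 1" "real j + 3" \<theta>] \<theta> by simp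
        finally have "M * (\<theta> * (1 / (real j + 3)) * 2) \<le> d"
          unfolding d_def using M12 by (intro mult_left_mono) auto
        then show ?thesis by (simp add: mult_ac)
      qed
      then have d_pos: "0 \<le> d" using M12 \<theta> by (intro order_trans[OF _ d_ge]) auto
      \<comment> \<open>The difference of the relations \<open>(1 + s j) * x j = s j + j * h\<close> at the two nodes.\<close>
      have gap: "(1 + s (j + 2)) * \<eta> = h * (2 + d * (1 - x j))"
      proof -
        have "(1 + s (j + 2)) * \<eta> = (1 + s (j + 2)) * x (j + 2) - (1 + s j) * x j - (s (j + 2) - s j) * x j"
          by (simp add: \<eta>_def algebra_simps)
        also have "\<dots> = h * (2 + d * (1 - x j))"
          unfolding sx \<delta> using \<delta> by (simp add: algebra_simps)
        finally show ?thesis .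
      qed
      have rhs: "0 \<le> h * (2 + d * (1 - x j))"
        using h d_pos xb[OF j] \<omega> by (intro mult_nonneg_nonneg add_nonneg_nonneg) auto
      have \<eta>0: "0 \<le> \<eta>" using rhs s0[of "j + 2"] unfolding gap[symmetric] by (simp add: zero_le_mult_iff)
      have \<eta>_le: "\<eta> \<le> h * (2 + d)"
      proof -
        have "\<eta> \<le> (1 + s (j + 2)) * \<eta>" using \<eta>0 s0[of "j + 2"] by (simp add: algebra_simps)
        also have "\<dots> \<le> h * (2 + d * 1)"
          unfolding gap using h d_pos x0[of j] by (intro mult_left_mono add_mono) auto
        finally show ?thesis by simp
      qed
      have x2: "h * ((real j + 3) / 2) \<le> x (j + 2)"
      proof -
        have "1 * h \<le> M * h" using M12 h by (intro mult_right_mono) auto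
        then have "h * (real j + 3) \<le> s (j + 2) + real (j + 2) * h"
          using s_ge[of "j + 2"] by (simp add: algebra_simps)
        then show ?thesis using xlow[OF J] by simp
      qed
      then have x2pos: "0 < x (j + 2)" using h by (intro less_le_trans[OF _ x2]) auto
      have key: "2 * p (x (j + 2)) \<le> (2 + d * \<omega>) * p (x j)"
      proof (cases "d0 \<le> d")
        case True
        have "x (j + 2) \<le> 8 * x j"
        proof -
          have "(real j + 3) powr \<theta> \<le> (3 * (real j + 1)) powr \<theta>" using \<theta> by (intro powr_mono2) auto
          also have "\<dots> = 3 powr \<theta> * (real j + 1) powr \<theta>" by (rule powr_mult)
          also have "\<dots> \<le> 3 powr 1 * (real j + 1) powr \<theta>" using \<theta> by (intro mult_right_mono powr_mono) auto
          finally have "M * h * (real j + 3) powr \<theta> \<le> M * h * (3 * (real j + 1) powr \<theta>)"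
            using M12 h by (intro mult_left_mono) auto
          then have "s (j + 2) \<le> 3 * s j" by (simp add: s_def algebra_simps)
          moreover have "2 * h \<le> M * h" using M12 h by (intro mult_right_mono) auto
          then have "2 * h \<le> s j" using s_ge[of j] by simp
          ultimately have "s (j + 2) + real (j + 2) * h \<le> 4 * s j + 1 * (real j * h)"
            by (simp add: algebra_simps)
          also have "\<dots> \<le> 4 * s j + 4 * (real j * h)"
            using jh0[of j] by (intro add_left_mono mult_right_mono) auto
          also have "\<dots> = 8 * ((s j + real j * h) / 2)" by simp
          also have "\<dots> \<le> 8 * x j" using xlow[OF j] by (intro mult_left_mono) auto
          finally show ?thesis using xup[of "j + 2"] by simp
        qed
        then have "p (x (j + 2)) \<le> C' * p (x j)" using x0 xb[OF J] xb[OF j] by (intro C') auto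
        then have "2 * p (x (j + 2)) \<le> d0 * \<omega> * p (x j)" using \<omega> by (simp add: d0_def)
        also have "\<dots> \<le> d * \<omega> * p (x j)"
          using True \<omega> p0[OF j] by (intro mult_right_mono) auto
        also have "\<dots> \<le> (2 + d * \<omega>) * p (x j)" using p0[OF j] by (intro mult_right_mono) auto
        finally show ?thesis .
      next
        case False
        define E where "E = C * (2 * (2 + d0) / (real j + 3))"
        have E0: "0 \<le> E" using C(1) d0 by (simp add: E_def)
        have "\<eta> / x (j + 2) \<le> (h * (2 + d0)) / (h * ((real j + 3) / 2))"
        proof (rule frac_le)
          show "\<eta> \<le> h * (2 + d0)"
            using False h by (intro order_trans[OF \<eta>_le] mult_left_mono) auto
        qed (use x2 h d0 in auto)
        also have "\<dots> = (2 + d0) / ((real j + 3) / 2)" using h by (intro mult_divide_mult_cancel_left) auto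
        also have "\<dots> = 2 * (2 + d0) / (real j + 3)" by simp
        finally have "C * (\<eta> / x (j + 2)) * p (x (j + 2)) \<le> E * p (x (j + 2))"
          unfolding E_def using C(1) p0[OF J] by (intro mult_right_mono mult_left_mono) auto
        moreover have "p (x (j + 2)) - p (x j) \<le> C * (\<eta> / x (j + 2)) * p (x (j + 2))"
          unfolding \<eta>_def using x2pos xb[OF J] \<eta>0 by (intro C) (auto simp: \<eta>_def)
        ultimately have pj: "(1 - E) * p (x (j + 2)) \<le> p (x j)" by (simp add: algebra_simps)
        have E: "(2 + d * \<omega>) * E \<le> d * \<omega>"
        proof -
          have "(2 + d * \<omega>) * E \<le> (2 + d0 * \<omega>) * E"
            using E0 False \<omega> by (intro mult_right_mono add_left_mono) auto
          also have "\<dots> = 2 * (C * (2 + d0) * (2 + d0 * \<omega>)) / (real j + 3)" by (simp add: E_def)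
          also have "\<dots> \<le> 2 * (M * (\<theta> * \<omega>)) / (real j + 3)"
            using M(2) \<theta> \<omega> by (intro divide_right_mono mult_left_mono) (auto simp: pos_divide_le_eq)
          also have "\<dots> = 2 * M * \<theta> / (real j + 3) * \<omega>" by simp
          also have "\<dots> \<le> d * \<omega>" using d_ge \<omega> by (intro mult_right_mono) auto
          finally show ?thesis .
        qed
        have "2 * p (x (j + 2)) \<le> (2 + d * \<omega> - (2 + d * \<omega>) * E) * p (x (j + 2))"
          using E p0[OF J] by (intro mult_right_mono) auto
        also have "\<dots> = (2 + d * \<omega>) * ((1 - E) * p (x (j + 2)))" by (simp add: algebra_simps)
        also have "\<dots> \<le> (2 + d * \<omega>) * p (x j)"
          using pj d_pos \<omega> by (intro mult_left_mono) auto
        finally show ?thesis .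
      qed
      have "2 * h * p (x (j + 2)) \<le> h * ((2 + d * \<omega>) * p (x j))"
        using mult_left_mono[OF key, of h] h by (simp add: mult_ac)
      also have "\<dots> \<le> h * ((2 + d * (1 - x j)) * p (x j))"
        using h d_pos xb[OF j] p0[OF j] by (intro mult_left_mono mult_right_mono add_left_mono) auto
      also have "\<dots> = (1 + s (j + 2)) * (\<eta> * p (x j))" using gap by (simp add: mult.assoc[symmetric])
      also have "\<dots> \<le> (1 + s (j + 2)) * (\<Phi> (x (j + 2)) - \<Phi> (x j))"
        unfolding \<eta>_def using s0[of "j + 2"] \<eta>0 xb[OF J] \<omega>
        by (intro mult_left_mono \<Phi>_diff_ge) (auto simp: \<eta>_def)
      finally have "2 * h * p (x (j + 2)) \<le> (1 + s (j + 2)) * \<Phi> (x (j + 2)) - (1 + s (j + 2)) * \<Phi> (x j)"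
        by (simp add: algebra_simps)
      moreover have "(1 + s j) * \<Phi> (x j) \<le> (1 + s (j + 2)) * \<Phi> (x j)"
        using smono[of j "j + 2"] \<Phi>_nonneg[of "x j"] xb[OF j] \<omega> by (intro mult_right_mono) auto
      ultimately show "(1 + s j) * \<Phi> (x j) + 2 * h * p (x (j + 2)) \<le> (1 + s (j + 2)) * \<Phi> (x (j + 2))"
        by simp
    qed
    then show "\<exists>s. 0 \<le> s \<and> s \<le> 1 \<and> s \<le> 2 * M * h powr (1 - \<theta>) \<and> V n \<le> p (rescale (1 + s) (real n * h))"
      using s0[of n] s1[OF n] s_le[OF n] by (auto simp: x_def)
  qed
qed

text \<open>
  Far from 0 the shifts are \<open>M h j powr \<theta>\<close> as in the upper bound. Near 0 such a shift would exceed
  \<open>j h\<close> and the shifted solution would vanish, which breaks the local condition at the point where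
  it becomes positive. There the shift \<open>(1 - \<epsilon>) j h\<close> is used instead, which compresses the first
  points of the grid by the factor \<open>\<epsilon>\<close>: steps of length about \<open>2 \<epsilon> h\<close> leave room for the doubling
  constant. The minimum of the two covers both phases, and the first phase consists of boundedly
  many points.
\<close>

lemma midpoint_lower_bound:
  assumes X: "0 < X" "X < 1" and \<theta>: "0 < \<theta>" "\<theta> < 1" and c: "0 < c"
  obtains M h0 where "0 < M" "0 < h0"
    "\<And>h V n. \<lbrakk>0 < h; h \<le> h0; midpoint_recursion X h V; c * h powr \<gamma> \<le> V 1; real n * h \<le> X\<rbrakk> \<Longrightarrow>
      \<exists>s. 0 \<le> s \<and> s \<le> 1 / 2 \<and> s \<le> M * h powr (1 - \<theta>) \<and> p (rescale (1 - s) (real n * h)) \<le> V n"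
proof -
  define \<omega> where "\<omega> = 1 - X"
  have \<omega>: "0 < \<omega>" using X by (simp add: \<omega>_def)
  obtain C where C: "0 < C" "\<And>x y. \<lbrakk>0 < y; x \<le> y; y \<le> X\<rbrakk> \<Longrightarrow> p y - p x \<le> C * ((y - x) / y) * p y"
    using p_relative_lipschitz[OF X(2)] by metis
  obtain C' where C': "1 \<le> C'"
      "\<And>x y. \<lbrakk>0 \<le> y; y \<le> 8 * x; x \<le> X; y \<le> X\<rbrakk> \<Longrightarrow> p y \<le> C' * p x"
    using p_doubling[OF X(2), of 8] by (metis zero_less_numeral)
  obtain \<kappa> where \<kappa>: "0 < \<kappa>" "\<And>x. \<lbrakk>0 \<le> x; x \<le> X\<rbrakk> \<Longrightarrow> p x \<le> \<kappa> * x powr \<gamma>"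
    using p_le_power[OF X(2)] by metis
  \<comment> \<open>The first entry beats the doubling constant, the second one the starting value.\<close>
  define \<epsilon> where "\<epsilon> = min (1 / (4 * C')) ((c / \<kappa>) powr (1 / \<gamma>) / 2)"
  have \<epsilon>0: "0 < \<epsilon>" using C'(1) c \<kappa>(1) by (simp add: \<epsilon>_def)
  have \<epsilon>C: "4 * \<epsilon> * C' \<le> 1"
  proof -
    have "\<epsilon> \<le> 1 / (4 * C')" by (simp add: \<epsilon>_def)
    then show ?thesis using C'(1) by (simp add: field_simps)
  qed
  have "4 * \<epsilon> * 1 \<le> 4 * \<epsilon> * C'" using C'(1) \<epsilon>0 by (intro mult_left_mono) auto
  then have \<epsilon>4: "4 * \<epsilon> \<le> 1" using \<epsilon>C by simp
  have \<epsilon>c: "2 * \<epsilon> \<le> (c / \<kappa>) powr (1 / \<gamma>)" by (simp add: \<epsilon>_def min_def)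
  define M where "M = max 4 (4 * C / (\<epsilon> * \<theta> * \<omega>))"
  have M4: "4 \<le> M" by (simp add: M_def)
  have MC: "4 * C / \<epsilon> \<le> M * \<theta> * \<omega>"
  proof -
    have "4 * C / (\<epsilon> * \<theta> * \<omega>) \<le> M" by (simp add: M_def)
    then show ?thesis using \<epsilon>0 \<theta> \<omega> by (simp add: field_simps)
  qed
  \<comment> \<open>Upper bound for the indices of the first phase, as \<open>(1 - \<epsilon>) J \<le> M J powr \<theta>\<close> and \<open>1 - \<epsilon> \<ge> 1 / 2\<close>.\<close>
  define n0 where "n0 = (2 * M) powr (1 / (1 - \<theta>))"
  have n0: "0 < n0" using M4 by (simp add: n0_def)
  have n0': "n0 powr (1 - \<theta>) = 2 * M" using M4 \<theta> by (simp add: n0_def powr_powr)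
  define h0 where "h0 = \<epsilon> / n0"
  have h0: "0 < h0" using \<epsilon>0 n0 by (simp add: h0_def)
  show thesis
  proof (rule that[of M h0])
    show "0 < M" "0 < h0" using M4 h0 by auto
    fix h V n
    assume h: "0 < h" "h \<le> h0" and V: "midpoint_recursion X h V" "c * h powr \<gamma> \<le> V 1"
      and n: "real n * h \<le> X"
    have hn0: "n0 * h \<le> \<epsilon>" using h n0 by (simp add: h0_def field_simps)
    define s where "s j = h * min ((1 - \<epsilon>) * real j) (M * real j powr \<theta>)" for j
    define x where "x j = rescale (1 - s j) (real j * h)" for j
    have s0: "0 \<le> s j" for j using M4 h \<epsilon>4 \<epsilon>0 by (simp add: s_def)
    have smono: "s i \<le> s j" if "i \<le> j" for i j
      unfolding s_def using that \<theta> M4 h \<epsilon>4 \<epsilon>0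
      by (intro mult_left_mono min.mono powr_mono2) auto
    have sA: "s j \<le> (1 - \<epsilon>) * (real j * h)" for j
      using mult_left_mono[OF min.cobounded1[of "(1 - \<epsilon>) * real j" "M * real j powr \<theta>"], of h] h
      by (simp add: s_def mult_ac)
    have sB: "s j \<le> M * h * real j powr \<theta>" for j
      using mult_left_mono[OF min.cobounded2[of "(1 - \<epsilon>) * real j" "M * real j powr \<theta>"], of h] h
      by (simp add: s_def mult_ac)
    have jh0: "0 \<le> real j * h" for j using h by simp
    have sj: "\<epsilon> * (real j * h) \<le> real j * h - s j" for j using sA[of j] by (simp add: algebra_simps)
    have sjh: "s j \<le> real j * h" for j
      using sj[of j] mult_nonneg_nonneg[of \<epsilon> "real j * h"] \<epsilon>0 jh0[of j] by linarith
    have s_le: "s j \<le> M * h powr (1 - \<theta>)" if "real j * h \<le> X" for j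
    proof -
      have "real j powr \<theta> \<le> (1 / h) powr \<theta>"
        using h \<theta> that X by (intro powr_mono2) (auto simp: field_simps)
      also have "\<dots> = h powr - \<theta>" using h by (simp add: powr_divide powr_minus_divide)
      finally have "M * h * real j powr \<theta> \<le> M * h * h powr - \<theta>"
        using M4 h by (intro mult_left_mono) auto
      also have "\<dots> = M * h powr (1 - \<theta>)" using h powr_add[of h 1 "- \<theta>"] by simp
      finally show ?thesis using sB[of j] by simp
    qed
    have s2: "s j \<le> 1 / 2" if "real j * h \<le> X" for j
    proof -
      have "n0 * h \<le> 1" using hn0 \<epsilon>4 by simp
      then have "h powr (1 - \<theta>) \<le> (1 / n0) powr (1 - \<theta>)"
        using h n0 \<theta> by (intro powr_mono2) (auto simp: field_simps)
      also have "\<dots> = 1 / (2 * M)" using n0 by (simp add: powr_divide n0')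
      finally have "M * h powr (1 - \<theta>) \<le> M * (1 / (2 * M))" using M4 by (intro mult_left_mono) auto
      then show ?thesis using s_le[OF that] M4 by simp
    qed
    have sx: "(1 - s j) * x j = real j * h - s j" if "real j * h \<le> X" for j
      unfolding x_def using s2[OF that] by (subst rescale_mult) auto
    have xlow: "real j * h - s j \<le> x j" and x0: "0 \<le> x j" if "real j * h \<le> X" for j
    proof -
      have "0 \<le> (1 - s j) * x j" unfolding sx[OF that] using sjh[of j] by simp
      then show *: "0 \<le> x j" using s2[OF that] by (simp add: zero_le_mult_iff)
      show "real j * h - s j \<le> x j"
        unfolding sx[OF that, symmetric] using * s0[of j] by (simp add: algebra_simps)
    qed
    have xup: "x j \<le> 2 * (real j * h - s j)" if "real j * h \<le> X" for j
      using mult_right_mono[of "1/2" "1 - s j" "x j"] s2[OF that] x0[OF that] sx[OF that] by simp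
    have xj: "x j \<le> real j * h" if "real j * h \<le> X" for j
    proof -
      have "rescale (1 - s j) (real j * h) \<le> rescale 1 (real j * h)"
        using that X s0[of j] s2[OF that] by (intro rescale_mono_factor) auto
      then show ?thesis by (simp add: x_def rescale_def)
    qed
    have xX: "x j \<le> X" if "real j * h \<le> X" for j using xj[OF that] that by simp
    have x1: "x j < 1" if "real j * h \<le> X" for j using xX[OF that] X by simp
    have p0: "0 \<le> p (x j)" if "real j * h \<le> X" for j using x1[OF that] by (intro p_nonneg)
    have earlier: "real i * h \<le> X" if "i \<le> j" "real j * h \<le> X" for i j
    proof -
      have "real i * h \<le> real j * h" using that h by (intro mult_right_mono) auto
      then show ?thesis using that(2) by simp
    qed
    have phaseA: "x J \<le> 2 * \<epsilon> * (real J * h)" if "(1 - \<epsilon>) * real J \<le> M * real J powr \<theta>" "real J * h \<le> X" for J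
    proof -
      have "s J = (1 - \<epsilon>) * (real J * h)" using that by (simp add: s_def min_absorb1)
      then have "real J * h - s J = \<epsilon> * (real J * h)" by (simp add: algebra_simps)
      then show ?thesis using xup[OF that(2)] by simp
    qed
    have compare: "p (x J) \<le> C' * p (x j)"
      if "(1 - \<epsilon>) * real J \<le> M * real J powr \<theta>" "real J * h \<le> X" "1 \<le> j" "j \<le> J" "J \<le> j + 2" for j J
    proof -
      have j: "real j * h \<le> X" using that by (intro earlier[of j J]) auto
      have "x J \<le> 2 * \<epsilon> * (real J * h)" by (rule phaseA) (use that in auto)
      also have "\<dots> \<le> 2 * \<epsilon> * (3 * real j * h)" 
        using \<epsilon>0 h that by (intro mult_left_mono mult_right_mono) auto
      also have "\<dots> \<le> 8 * (\<epsilon> * (real j * h))" using \<epsilon>0 h by simp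
      also have "\<dots> \<le> 8 * x j" using sj[of j] xlow[OF j] by (intro mult_left_mono) auto
      finally show ?thesis using x0 xX j that(2) by (intro C') auto
    qed
    have "p (x n) \<le> V n"
    proof (rule shifted_le_midpoint[OF V(1) h(1) X(2) s0 smono _ sjh x_def _ _ _ _ _ n])
      show "s j < 1" if "real j * h \<le> X" for j using s2[OF that] by simp
      show "0 \<le> V 1" using V(2) c by (intro order_trans[OF _ V(2)]) auto
      assume hX: "h \<le> X"
      have "x 1 \<le> 2 * \<epsilon> * (real 1 * h)" using hX M4 \<epsilon>0 by (intro phaseA) auto
      also have "\<dots> \<le> (c / \<kappa>) powr (1 / \<gamma>) * h" using \<epsilon>c h by simp
      finally have x1: "x 1 \<le> (c / \<kappa>) powr (1 / \<gamma>) * h" .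
      have "p (x 1) \<le> \<kappa> * x 1 powr \<gamma>" using hX x0[of 1] xX[of 1] by (intro \<kappa>) auto
      also have "\<dots> \<le> \<kappa> * ((c / \<kappa>) powr (1 / \<gamma>) * h) powr \<gamma>"
        using x1 x0[of 1] hX \<gamma>_pos \<kappa>(1) by (intro mult_left_mono powr_mono2) auto
      also have "\<dots> = c * h powr \<gamma>" using c \<kappa>(1) \<gamma>_pos h by (simp add: powr_mult powr_powr)
      also note V(2)
      finally show "p (x 1) \<le> V 1" .
    next
      fix i :: nat assume i: "2 \<le> i"
      have "real (i mod 2 + 1) \<le> (3/4) * real i"
      proof (cases "i = 2")
        case False
        have "i mod 2 \<le> 1" by simp
        moreover have "3 \<le> i" using i False by simp
        ultimately have "real (i mod 2 + 1) \<le> 2" "3 \<le> real i" by simp_all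
        then show ?thesis by simp
      qed simp
      also have "\<dots> \<le> (1 - \<epsilon>) * real i" using \<epsilon>4 by (intro mult_right_mono) auto
      finally have 1: "real (i mod 2 + 1) \<le> (1 - \<epsilon>) * real i" .
      have "real (i mod 2 + 1) \<le> 4 * 1" by simp
      also have "\<dots> \<le> M * real i powr \<theta>" using M4 i \<theta> by (intro mult_mono ge_one_powr_ge_zero) auto
      finally have "real (i mod 2 + 1) * h \<le> min ((1 - \<epsilon>) * real i) (M * real i powr \<theta>) * h"
        using 1 h by (intro mult_right_mono) auto
      then show "real (i mod 2 + 1) * h \<le> s i" by (simp add: s_def mult_ac)
    next
      fix j J :: nat assume j: "j \<in> {1, 2}" and J: "J \<in> {j + 1, j + 2}" "real J * h \<le> X"
      have J4: "real J \<le> 4" "1 \<le> real J" using j J by auto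
      have jX: "real j * h \<le> X" using J by (intro earlier[of j J]) auto
      have "(1 - \<epsilon>) * real J \<le> 1 * 4" using J4 \<epsilon>0 \<epsilon>4 by (intro mult_mono) auto
      also have "\<dots> \<le> M * real J powr \<theta>"
        using M4 J4 \<theta> mult_mono[of 4 M 1 "real J powr \<theta>"] by (simp add: ge_one_powr_ge_zero)
      finally have A: "(1 - \<epsilon>) * real J \<le> M * real J powr \<theta>" .
      have "(1 - s J) * \<Phi> (x J) \<le> 1 * \<Phi> (x J)"
        using s0[of J] \<Phi>_nonneg[OF x1[OF J(2)]] by (intro mult_right_mono) auto
      also have "1 * \<Phi> (x J) \<le> x J * p (x J)"
        using \<Phi>_diff_le[of 0 "x J"] \<Phi>_neg[of 0] x0[OF J(2)] x1[OF J(2)] by simp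
      also have "\<dots> \<le> (8 * \<epsilon> * h) * (C' * p (x j))"
      proof (rule mult_mono)
        have "x J \<le> 2 * \<epsilon> * (real J * h)" by (rule phaseA[OF A J(2)])
        also have "\<dots> \<le> 2 * \<epsilon> * (4 * h)" using J4 \<epsilon>0 h by (intro mult_left_mono mult_right_mono) auto
        finally show "x J \<le> 8 * \<epsilon> * h" by simp
        show "p (x J) \<le> C' * p (x j)" using j J by (intro compare[OF A J(2)]) auto
      qed (use \<epsilon>0 h p0[OF J(2)] in auto)
      also have "\<dots> = 2 * h * ((4 * \<epsilon> * C') * p (x j))" by simp
      also have "\<dots> \<le> 2 * h * (1 * p (x j))"
        using \<epsilon>C h p0[OF jX] by (intro mult_left_mono mult_right_mono) auto
      finally show "(1 - s J) * \<Phi> (x J) \<le> 2 * h * p (x j)" by simp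
    next
      fix j J :: nat assume j1: "1 \<le> j" and J: "J \<in> {j + 1, j + 2}" "real J * h \<le> X"
      have jX: "real j * h \<le> X" using J by (intro earlier[of j J]) auto
      have jJ: "j < J" "J \<le> j + 2" using J by auto
      have ss: "(1 - s J) * \<Phi> (x j) \<le> (1 - s j) * \<Phi> (x j)"
        using smono[of j J] jJ \<Phi>_nonneg[OF x1[OF jX]] by (intro mult_right_mono) auto
      show "(1 - s J) * \<Phi> (x J) \<le> (1 - s j) * \<Phi> (x j) + 2 * h * p (x j)"
      proof (cases "x J \<le> x j")
        case True
        have "(1 - s J) * \<Phi> (x J) \<le> (1 - s J) * \<Phi> (x j)"
          using s2[OF J(2)] \<Phi>_mono[OF True x1[OF jX]] by (intro mult_left_mono) auto
        also have "\<dots> \<le> (1 - s j) * \<Phi> (x j)" by (rule ss)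
        also have "\<dots> \<le> (1 - s j) * \<Phi> (x j) + 2 * h * p (x j)" using h p0[OF jX] by simp
        finally show ?thesis .
      next
        case False
        define \<eta> where "\<eta> = x J - x j"
        define \<Delta> where "\<Delta> = real J * h - real j * h"
        define \<delta> where "\<delta> = s J - s j"
        have \<eta>: "0 < \<eta>" using False by (simp add: \<eta>_def)
        have \<Delta>: "0 \<le> \<Delta>" "\<Delta> \<le> 2 * h"
          using jJ h J(1) by (auto simp: \<Delta>_def algebra_simps)
        have \<Delta>eq: "\<Delta> = (real J - real j) * h" by (simp add: \<Delta>_def algebra_simps)
        have \<delta>0: "0 \<le> \<delta>" using smono[of j J] jJ by (simp add: \<delta>_def)
        have gap: "(1 - s J) * \<eta> = \<Delta> - \<delta> * (1 - x j)"
        proof -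
          have "(1 - s J) * \<eta> = (1 - s J) * x J - (1 - s j) * x j + (s J - s j) * x j"
            by (simp add: \<eta>_def algebra_simps)
          then show ?thesis unfolding sx[OF J(2)] sx[OF jX] \<Delta>_def \<delta>_def by (simp add: algebra_simps)
        qed
        have key: "(\<Delta> - \<delta> * (1 - x j)) * p (x J) \<le> 2 * h * p (x j)"
        proof (cases "(1 - \<epsilon>) * real J \<le> M * real J powr \<theta>")
          case True
          have "s J = (1 - \<epsilon>) * (real J * h)" using True by (simp add: s_def min_absorb1)
          then have \<delta>: "(1 - \<epsilon>) * \<Delta> \<le> \<delta>" using sA[of j] by (simp add: \<delta>_def \<Delta>_def algebra_simps)
          have "real J * h \<le> \<epsilon>"
          proof -
            have J0: "0 < real J" using jJ by simp
            have "(1 / 2) * real J \<le> (1 - \<epsilon>) * real J" using \<epsilon>4 by (intro mult_right_mono) auto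
            also note True
            finally have "real J \<le> 2 * M * real J powr \<theta>" by simp
            then have "real J powr 1 / real J powr \<theta> \<le> 2 * M" using J0 by (simp add: field_simps)
            then have "real J powr (1 - \<theta>) \<le> n0 powr (1 - \<theta>)" by (simp only: n0' powr_diff[of "real J"])
            then have "real J \<le> n0" by (rule powr_le_cancel) (use n0 \<theta> in auto)
            then have "real J * h \<le> n0 * h" using h by (intro mult_right_mono) auto
            then show ?thesis using hn0 by simp
          qed
          moreover have "real j * h \<le> real J * h" using jJ h by (intro mult_right_mono) auto
          ultimately have xj\<epsilon>: "x j \<le> \<epsilon>" using xj[OF jX] by simp
          have "(1 - 2 * \<epsilon>) * \<Delta> \<le> ((1 - \<epsilon>) * (1 - \<epsilon>)) * \<Delta>"
            using \<Delta> by (intro mult_right_mono) (auto simp: algebra_simps)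
          also have "\<dots> = ((1 - \<epsilon>) * \<Delta>) * (1 - \<epsilon>)" by simp
          also have "\<dots> \<le> \<delta> * (1 - x j)"
            using \<delta> xj\<epsilon> \<epsilon>4 \<delta>0 \<epsilon>0 by (intro mult_mono) auto
          finally have "\<Delta> - \<delta> * (1 - x j) \<le> 2 * \<epsilon> * \<Delta>" by (simp add: algebra_simps)
          also have "\<dots> \<le> 2 * \<epsilon> * (2 * h)" using \<Delta> \<epsilon>0 by (intro mult_left_mono) auto
          finally have "(\<Delta> - \<delta> * (1 - x j)) * p (x J) \<le> (2 * \<epsilon> * (2 * h)) * p (x J)"
            using p0[OF J(2)] by (intro mult_right_mono) auto
          also have "\<dots> \<le> (2 * \<epsilon> * (2 * h)) * (C' * p (x j))"
            using \<epsilon>0 h j1 jJ J by (intro mult_left_mono compare[OF True J(2)]) auto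
          also have "\<dots> = (4 * \<epsilon> * C') * (h * p (x j))" by simp
          also have "\<dots> \<le> 1 * (h * p (x j))"
            using \<epsilon>C h p0[OF jX] by (intro mult_right_mono) auto
          also have "\<dots> \<le> 2 * (h * p (x j))"
            using h p0[OF jX] by (intro mult_right_mono) auto
          finally show ?thesis by simp
        next
          case False
          define E where "E = 4 * C / \<epsilon> / real J"
          have J0: "0 < real J" using jJ by simp
          have "s J = M * h * real J powr \<theta>" using False by (simp add: s_def min_absorb2)
          then have "M * h * (real J powr \<theta> - real j powr \<theta>) \<le> \<delta>"
            using sB[of j] by (simp add: \<delta>_def algebra_simps)
          moreover have "M * h * (\<theta> * (1 / real J) * (real J - real j)) \<le> M * h * (real J powr \<theta> - real j powr \<theta>)"
          proof (rule mult_left_mono)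
            have "1 / real J \<le> real J powr (\<theta> - 1)"
              using powr_mono[of "-1" "\<theta> - 1" "real J"] \<theta> jJ by (simp add: powr_minus_divide)
            then have "\<theta> * (1 / real J) * (real J - real j) \<le> \<theta> * real J powr (\<theta> - 1) * (real J - real j)"
              using \<theta> jJ by (intro mult_right_mono mult_left_mono) auto
            also have "\<dots> \<le> real J powr \<theta> - real j powr \<theta>"
              using powr_increment_ge[of "real j" "real J" \<theta>] \<theta> J0 by simp
            finally show "\<theta> * (1 / real J) * (real J - real j) \<le> real J powr \<theta> - real j powr \<theta>" .
          qed (use M4 h in auto)
          ultimately have \<delta>: "M * \<theta> / real J * \<Delta> \<le> \<delta>" by (simp add: \<Delta>eq mult_ac)
          have "E * \<Delta> \<le> (M * \<theta> * \<omega> / real J) * \<Delta>"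
            unfolding E_def using MC J0 \<Delta> by (intro mult_right_mono divide_right_mono) auto
          also have "\<dots> = (M * \<theta> / real J * \<Delta>) * \<omega>" by simp
          also have "\<dots> \<le> \<delta> * (1 - x j)"
            using \<delta> \<delta>0 xX[OF jX] \<omega> by (intro mult_mono) (auto simp: \<omega>_def)
          finally have 1: "\<Delta> - \<delta> * (1 - x j) \<le> \<Delta> * (1 - E)" by (simp add: algebra_simps)
          have xJ: "\<epsilon> * (real J * h) \<le> x J" using sj[of J] xlow[OF J(2)] by simp
          have xJ0: "0 < x J" using J0 h \<epsilon>0 by (intro less_le_trans[OF _ xJ]) auto
          have "\<eta> / 2 \<le> (1 - s J) * \<eta>" using \<eta> s2[OF J(2)] mult_right_mono[of "1/2" "1 - s J" \<eta>] by simp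
          also have "\<dots> \<le> \<Delta>" unfolding gap using \<delta>0 x1[OF jX] by simp
          finally have "\<eta> \<le> 4 * h" using \<Delta> by simp
          then have "\<eta> / x J \<le> (4 * h) / (\<epsilon> * (real J * h))"
            using xJ \<epsilon>0 J0 h by (intro frac_le) auto
          also have "\<dots> = 4 / \<epsilon> / real J" using h by simp
          finally have "C * (\<eta> / x J) * p (x J) \<le> C * (4 / \<epsilon> / real J) * p (x J)"
            using C(1) p0[OF J(2)] by (intro mult_right_mono mult_left_mono) auto
          moreover have "p (x J) - p (x j) \<le> C * (\<eta> / x J) * p (x J)"
            unfolding \<eta>_def using xJ0 xX[OF J(2)] \<eta> by (intro C) (auto simp: \<eta>_def)
          ultimately have pj: "(1 - E) * p (x J) \<le> p (x j)" by (simp add: E_def algebra_simps)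
          have "(\<Delta> - \<delta> * (1 - x j)) * p (x J) \<le> \<Delta> * (1 - E) * p (x J)"
            using 1 p0[OF J(2)] by (intro mult_right_mono) auto
          also have "\<dots> \<le> \<Delta> * p (x j)" using mult_left_mono[OF pj \<Delta>(1)] by (simp add: mult_ac)
          also have "\<dots> \<le> 2 * h * p (x j)" using \<Delta> p0[OF jX] by (intro mult_right_mono) auto
          finally show ?thesis .
        qed
        have "(1 - s J) * (\<Phi> (x J) - \<Phi> (x j)) \<le> (1 - s J) * (\<eta> * p (x J))"
          unfolding \<eta>_def using s2[OF J(2)] False x1[OF J(2)] by (intro mult_left_mono \<Phi>_diff_le) auto
        also have "\<dots> \<le> 2 * h * p (x j)" using key by (simp add: gap[symmetric] mult.assoc)
        finally show ?thesis using ss by (simp add: algebra_simps)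
      qed
    qed
    then show "\<exists>s. 0 \<le> s \<and> s \<le> 1 / 2 \<and> s \<le> M * h powr (1 - \<theta>) \<and> p (rescale (1 - s) (real n * h)) \<le> V n"
      using s0[of n] s2[OF n] s_le[OF n] by (auto simp: x_def)
  qed
qed

text \<open>
  Both bounds are values of \<open>p\<close> at points at distance \<open>O(h powr (1 - \<theta>))\<close> from \<open>n h\<close>, and away from 0
  the function \<open>p\<close> is Lipschitz continuous.
\<close>

lemma midpoint_error:
  assumes X: "0 < X" "X < 1" and \<theta>: "0 < \<theta>" "\<theta> < 1" and c: "0 < c" "0 < c'"
  obtains B h0 where "0 < B" "0 < h0"
    "\<And>h V n. \<lbrakk>0 < h; h \<le> h0; midpoint_recursion X h V; c * h powr \<gamma> \<le> V 1; V 1 \<le> c' * h powr \<gamma>;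
      0 < n; real n * h \<le> X\<rbrakk> \<Longrightarrow>
      \<bar>V n - p (real n * h)\<bar> \<le> B * h powr (1 - \<theta>) / (real n * h)"
proof -
  define b where "b = (1 + X) / 2"
  have b: "b < 1" using X by (simp add: b_def)
  obtain C where C: "0 < C" "\<And>x y. \<lbrakk>0 < y; x \<le> y; y \<le> b\<rbrakk> \<Longrightarrow> p y - p x \<le> C * ((y - x) / y) * p y"
    using p_relative_lipschitz[OF b] by metis
  obtain M h0 where up: "0 < M" "0 < h0"
    "\<And>h V n. \<lbrakk>0 < h; h \<le> h0; midpoint_recursion X h V; V 1 \<le> c' * h powr \<gamma>; real n * h \<le> X\<rbrakk> \<Longrightarrow>
      \<exists>s. 0 \<le> s \<and> s \<le> 1 \<and> s \<le> M * h powr (1 - \<theta>) \<and> V n \<le> p (rescale (1 + s) (real n * h))"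
    using midpoint_upper_bound[OF X \<theta> c(2)] by metis
  obtain M' h1 where lo: "0 < M'" "0 < h1"
    "\<And>h V n. \<lbrakk>0 < h; h \<le> h1; midpoint_recursion X h V; c * h powr \<gamma> \<le> V 1; real n * h \<le> X\<rbrakk> \<Longrightarrow>
      \<exists>s. 0 \<le> s \<and> s \<le> 1 / 2 \<and> s \<le> M' * h powr (1 - \<theta>) \<and> p (rescale (1 - s) (real n * h)) \<le> V n"
    using midpoint_lower_bound[OF X \<theta> c(1)] by metis
  define B where "B = C * (M + 2 * M') * (p b + 1)"
  show thesis
  proof (rule that[of B "min h0 h1"])
    show "0 < B" using C(1) up(1) lo(1) p_nonneg[OF b] by (simp add: B_def add_pos_nonneg)
    show "0 < min h0 h1" using up lo by simp
    fix h V n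
    assume h: "0 < h" "h \<le> min h0 h1" and V: "midpoint_recursion X h V" "c * h powr \<gamma> \<le> V 1" "V 1 \<le> c' * h powr \<gamma>"
      and n: "0 < n" "real n * h \<le> X"
    define z where "z = real n * h"
    have z: "0 < z" "z \<le> X" using n h by (auto simp: z_def)
    obtain s where s: "0 \<le> s" "s \<le> 1" "s \<le> M * h powr (1 - \<theta>)" "V n \<le> p (rescale (1 + s) z)"
      using up(3)[of h V n] h V n by (auto simp: z_def)
    obtain s' where s': "0 \<le> s'" "s' \<le> 1 / 2" "s' \<le> M' * h powr (1 - \<theta>)" "p (rescale (1 - s') z) \<le> V n"
      using lo(3)[of h V n] h V n by (auto simp: z_def)
    define x where "x = rescale (1 + s) z"
    define x' where "x' = rescale (1 - s') z"
    have id: "rescale 1 z = z" by (simp add: rescale_def)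
    have x'z: "x' \<le> z" unfolding x'_def using rescale_mono_factor[of z "1 - s'" 1] s' z X by (simp add: id)
    have zx: "z \<le> x" unfolding x_def using rescale_mono_factor[of z 1 "1 + s"] s z X by (simp add: id)
    have xb: "x \<le> b"
    proof -
      have "(1 - X) / 2 \<le> (1 - z) / (1 + s)" using s z X by (intro frac_le) auto
      then show ?thesis by (simp add: x_def rescale_def b_def field_simps)
    qed
    have diff: "x - x' \<le> (M + 2 * M') * h powr (1 - \<theta>)"
    proof -
      have "x - z = s * ((1 - z) / (1 + s))" using s by (simp add: x_def rescale_def field_simps)
      also have "\<dots> \<le> s * 1" using s z X by (intro mult_left_mono) (auto simp: divide_le_eq)
      finally have 1: "x - z \<le> M * h powr (1 - \<theta>)" using s by simp
      have "z - x' = s' * ((1 - z) / (1 - s'))" using s' by (simp add: x'_def rescale_def field_simps)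
      also have "\<dots> \<le> s' * 2" using s' z X by (intro mult_left_mono) (auto simp: divide_le_eq)
      finally have "z - x' \<le> 2 * (M' * h powr (1 - \<theta>))" using s' by simp
      then show ?thesis using 1 by (simp add: algebra_simps)
    qed
    have "p x' \<le> p z" "p z \<le> p x" using x'z zx xb b z X by (auto intro!: p_mono)
    then have "\<bar>V n - p z\<bar> \<le> p x - p x'"
      using s(4) s'(4) by (simp add: x_def x'_def abs_le_iff)
    also have "\<dots> \<le> C * ((x - x') / x) * p x" using z zx x'z xb by (intro C) auto
    also have "\<dots> \<le> C * ((M + 2 * M') * h powr (1 - \<theta>) / z) * (p b + 1)"
    proof (intro mult_mono mult_left_mono frac_le)
      show "p x \<le> p b + 1" using p_mono[OF xb b] by simp
    qed (use C(1) diff z zx x'z xb b up(1) lo(1) p_nonneg in auto)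
    also have "\<dots> = B * h powr (1 - \<theta>) / z" by (simp add: B_def)
    finally show "\<bar>V n - p (real n * h)\<bar> \<le> B * h powr (1 - \<theta>) / (real n * h)" by (simp add: z_def)
  qed
qed

end

section \<open>The kernel of the integral equation\<close>

lemma has_integral_endpoint_singularity:
  fixes \<alpha> R :: real
  assumes "\<alpha> < 1" "R \<le> 1"
  shows "((\<lambda>s. (1 - s) powr (- \<alpha>)) has_integral (1 - R) powr (1 - \<alpha>) / (1 - \<alpha>)) {R..1}"
proof -
  have "((\<lambda>s. (1 - s) powr (- \<alpha>)) has_integral
      - ((1 - 1) powr (1 - \<alpha>) / (1 - \<alpha>)) - - ((1 - R) powr (1 - \<alpha>) / (1 - \<alpha>))) {R..1}"
  proof (rule fundamental_theorem_of_calculus_interior)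
    show "continuous_on {R..1} (\<lambda>s. - ((1 - s) powr (1 - \<alpha>) / (1 - \<alpha>)))"
      using assms by (intro continuous_intros continuous_on_powr') auto
    fix s assume s: "s \<in> {R<..<1}"
    have "((\<lambda>s. (1 - s) powr (1 - \<alpha>)) has_real_derivative
        ((1 - \<alpha>) * (1 - s) powr (1 - \<alpha> - 1)) * (- 1)) (at s)"
      using s by (intro DERIV_chain2[OF has_real_derivative_powr]) (auto intro!: derivative_eq_intros)
    from DERIV_minus[OF DERIV_cdivide[OF this, of "1 - \<alpha>"]]
    have "((\<lambda>s. - ((1 - s) powr (1 - \<alpha>) / (1 - \<alpha>))) has_real_derivative (1 - s) powr (- \<alpha>)) (at s)"
      using assms by simp
    then show "((\<lambda>s. - ((1 - s) powr (1 - \<alpha>) / (1 - \<alpha>))) has_vector_derivative (1 - s) powr (- \<alpha>)) (at s)"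
      by (simp add: has_real_derivative_iff_has_vector_derivative)
  qed (use assms in auto)
  then show ?thesis by simp
qed

text \<open>
  The lower limit of the integral defining the kernel; its power \<open>2 / \<alpha>\<close> is \<open>(1 - z) / (1 - u)\<close>.
\<close>

definition kernel_start :: "real \<Rightarrow> real \<Rightarrow> real \<Rightarrow> real" where
  "kernel_start \<alpha> z u = ((1 - z) / (1 - u)) powr (\<alpha> / 2)"

definition kernel_integrand :: "real \<Rightarrow> real \<Rightarrow> real \<Rightarrow> real \<Rightarrow> real" where
  "kernel_integrand \<alpha> z u s =
     (s powr (2 / \<alpha>) * (1 - u) - (1 - \<alpha> / 2) * (1 - z)) * s powr (2 / \<alpha>) * (1 - s) powr (- \<alpha>)"

definition kernel_factor :: "real \<Rightarrow> real \<Rightarrow> real" where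
  "kernel_factor \<alpha> m = (m + 1) / m * (1 / Gamma (1 - \<alpha>))"

lemma kernel_altdef:
  "kernel \<alpha> m z u = kernel_factor \<alpha> m * integral {kernel_start \<alpha> z u..1} (kernel_integrand \<alpha> z u)"
  by (simp add: kernel_def kernel_start_def kernel_integrand_def[abs_def] kernel_factor_def)

lemma kernel_factor_pos: "\<lbrakk>\<alpha> < 1; 0 < m\<rbrakk> \<Longrightarrow> 0 < kernel_factor \<alpha> m"
  by (simp add: kernel_factor_def Gamma_real_pos)

lemma kernel_start_bounds:
  assumes "0 < \<alpha>" "\<alpha> < 1" "u \<le> z" "z < 1"
  shows "0 < kernel_start \<alpha> z u" "(1 - z) / (1 - u) \<le> kernel_start \<alpha> z u" "kernel_start \<alpha> z u \<le> 1"
    and "kernel_start \<alpha> z u \<le> 1 - \<alpha> / 2 * ((z - u) / (1 - u))"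
proof -
  have r: "0 < (1 - z) / (1 - u)" "(1 - z) / (1 - u) \<le> 1" using assms by auto
  show "0 < kernel_start \<alpha> z u" using assms by (simp add: kernel_start_def)
  show "kernel_start \<alpha> z u \<le> 1" unfolding kernel_start_def using r assms by (intro powr_le1) auto
  show "(1 - z) / (1 - u) \<le> kernel_start \<alpha> z u"
    unfolding kernel_start_def using r assms powr_mono'[of "\<alpha> / 2" 1 "(1 - z) / (1 - u)"] by simp
  have "kernel_start \<alpha> z u \<le> 1 + \<alpha> / 2 * ((1 - z) / (1 - u) - 1)"
    unfolding kernel_start_def using r assms by (intro powr_le_linear) auto
  also have "(1 - z) / (1 - u) - 1 = - ((z - u) / (1 - u))" using assms by (simp add: field_simps)
  finally show "kernel_start \<alpha> z u \<le> 1 - \<alpha> / 2 * ((z - u) / (1 - u))" by simp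
qed

lemma kernel_start_le:
  assumes "0 < \<alpha>" "\<alpha> < 1" "u \<le> z" "z < 1" "kernel_start \<alpha> z u \<le> s"
  shows "(1 - z) / (1 - u) \<le> s powr (2 / \<alpha>)" and "1 - z \<le> s powr (2 / \<alpha>) * (1 - u)"
proof -
  have "(1 - z) / (1 - u) = kernel_start \<alpha> z u powr (2 / \<alpha>)"
    using assms by (simp add: kernel_start_def powr_powr)
  also have "\<dots> \<le> s powr (2 / \<alpha>)" using assms by (intro powr_mono2) (auto simp: kernel_start_def)
  finally show "(1 - z) / (1 - u) \<le> s powr (2 / \<alpha>)" .
  then show "1 - z \<le> s powr (2 / \<alpha>) * (1 - u)" using assms by (simp add: pos_divide_le_eq)
qed

lemma kernel_bracket_ge:
  assumes "0 < \<alpha>" "\<alpha> < 1" "u \<le> z" "z < 1" "kernel_start \<alpha> z u \<le> s"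
  shows "\<alpha> / 2 * (1 - z) \<le> s powr (2 / \<alpha>) * (1 - u) - (1 - \<alpha> / 2) * (1 - z)"
  using kernel_start_le(2)[OF assms] by (simp add: algebra_simps)

text \<open>
  Both monotonicity and positivity of the kernel come from here: raising \<open>u\<close> shortens the interval
  of integration and lowers an integrand that is nonnegative there.
\<close>

lemma kernel_integrand_nonneg:
  assumes "0 < \<alpha>" "\<alpha> < 1" "u \<le> z" "z < 1" "kernel_start \<alpha> z u \<le> s"
  shows "0 \<le> kernel_integrand \<alpha> z u s"
proof -
  have "0 \<le> \<alpha> / 2 * (1 - z)" using assms by simp
  also note kernel_bracket_ge[OF assms]
  finally show ?thesis unfolding kernel_integrand_def by (intro mult_nonneg_nonneg) auto
qed

lemma kernel_integrand_integrable:
  assumes "0 < \<alpha>" "\<alpha> < 1" "0 < R" "R \<le> 1"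
  shows "kernel_integrand \<alpha> z u integrable_on {R..1}"
proof -
  let ?g = "\<lambda>s. (s powr (2 / \<alpha>) * (1 - u) - (1 - \<alpha> / 2) * (1 - z)) * s powr (2 / \<alpha>)"
  have g: "continuous_on {R..1} ?g" using assms by (intro continuous_intros) auto
  have "(\<lambda>s. (1 - s) powr (- \<alpha>)) absolutely_integrable_on {R..1}"
    using has_integral_endpoint_singularity[of \<alpha> R] assms
    by (intro nonnegative_absolutely_integrable_1) (auto simp: has_integral_iff)
  moreover have "?g \<in> borel_measurable (lebesgue_on {R..1})"
    using g by (intro continuous_imp_measurable_on_sets_lebesgue) auto
  moreover have "bounded (?g ` {R..1})"
    using g by (intro compact_imp_bounded compact_continuous_image) auto
  ultimately have "(\<lambda>s. ?g s * (1 - s) powr (- \<alpha>)) absolutely_integrable_on {R..1}"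
    by (intro absolutely_integrable_bounded_measurable_product_real) auto
  then show ?thesis
    unfolding kernel_integrand_def[abs_def] absolutely_integrable_on_def by blast
qed

lemma kernel_nonneg:
  assumes "0 < \<alpha>" "\<alpha> < 1" "0 < m" "u \<le> z" "z < 1"
  shows "0 \<le> kernel \<alpha> m z u"
  unfolding kernel_altdef using assms kernel_factor_pos[of \<alpha> m] kernel_start_bounds[of \<alpha> u z]
  by (intro mult_nonneg_nonneg integral_nonneg kernel_integrand_integrable) (auto intro: kernel_integrand_nonneg)

lemma kernel_antimono:
  assumes "0 < \<alpha>" "\<alpha> < 1" "0 < m" "u \<le> v" "v \<le> z" "z < 1"
  shows "kernel \<alpha> m z v \<le> kernel \<alpha> m z u"
proof -
  have "kernel_start \<alpha> z u \<le> kernel_start \<alpha> z v"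
    unfolding kernel_start_def using assms by (intro powr_mono2 divide_left_mono) auto
  moreover note kernel_start_bounds[of \<alpha> u z] kernel_start_bounds[of \<alpha> v z]
  ultimately have "integral {kernel_start \<alpha> z v..1} (kernel_integrand \<alpha> z u)
      \<le> integral {kernel_start \<alpha> z u..1} (kernel_integrand \<alpha> z u)"
    using assms
    by (intro integral_subset_le kernel_integrand_integrable) (auto intro!: kernel_integrand_nonneg)
  moreover have "integral {kernel_start \<alpha> z v..1} (kernel_integrand \<alpha> z v)
      \<le> integral {kernel_start \<alpha> z v..1} (kernel_integrand \<alpha> z u)"
    using assms kernel_start_bounds[of \<alpha> v z] unfolding kernel_integrand_def
    by (intro integral_le kernel_integrand_integrable[unfolded kernel_integrand_def[abs_def]]
        mult_right_mono diff_right_mono mult_left_mono) auto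
  ultimately show ?thesis
    unfolding kernel_altdef using kernel_factor_pos[of \<alpha> m] assms by (intro mult_left_mono) auto
qed

lemma kernel_rescale:
  assumes "0 < \<sigma>"
  shows "kernel \<alpha> m (rescale \<sigma> z) (rescale \<sigma> u) = kernel \<alpha> m z u / \<sigma>"
proof -
  have "kernel_start \<alpha> (rescale \<sigma> z) (rescale \<sigma> u) = kernel_start \<alpha> z u"
    using assms by (simp add: kernel_start_def one_minus_rescale)
  moreover have "kernel_integrand \<alpha> (rescale \<sigma> z) (rescale \<sigma> u) = (\<lambda>s. (1 / \<sigma>) * kernel_integrand \<alpha> z u s)"
    by (simp add: kernel_integrand_def one_minus_rescale fun_eq_iff diff_divide_distrib[symmetric])
  ultimately show ?thesis by (simp add: kernel_altdef)
qed

text \<open>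
  Away from \<open>z = 1\<close> the smooth part of the integrand is bounded below, and the singular factor
  integrates to a power of \<open>1 - kernel_start \<alpha> z u\<close>, which is comparable with \<open>z - u\<close> by Bernoulli's
  inequality.
\<close>

lemma kernel_ge_power:
  assumes "0 < \<alpha>" "\<alpha> < 1" "0 < m" "0 \<le> u" "u \<le> z" "z \<le> b" "b < 1"
  shows "kernel_factor \<alpha> m * (\<alpha> / 2 * (1 - b) * (1 - b)) * (\<alpha> / 2) powr (1 - \<alpha>) / (1 - \<alpha>) * (z - u) powr (1 - \<alpha>)
    \<le> kernel \<alpha> m z u"
proof -
  let ?R = "kernel_start \<alpha> z u"
  have z: "z < 1" using assms by simp
  note R = kernel_start_bounds[OF assms(1,2,5) z]
  have "(\<alpha> / 2 * (z - u)) powr (1 - \<alpha>) \<le> (1 - ?R) powr (1 - \<alpha>)"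
  proof (rule powr_mono2)
    have "(z - u) / 1 \<le> (z - u) / (1 - u)" using assms z by (intro divide_left_mono) auto
    then have "\<alpha> / 2 * (z - u) \<le> \<alpha> / 2 * ((z - u) / (1 - u))" using assms by (intro mult_left_mono) auto
    then show "\<alpha> / 2 * (z - u) \<le> 1 - ?R" using R(4) by simp
  qed (use assms in auto)
  then have "(\<alpha> / 2 * (1 - b) * (1 - b)) * ((\<alpha> / 2 * (z - u)) powr (1 - \<alpha>) / (1 - \<alpha>))
    \<le> (\<alpha> / 2 * (1 - b) * (1 - b)) * ((1 - ?R) powr (1 - \<alpha>) / (1 - \<alpha>))"
    using assms by (intro mult_left_mono divide_right_mono) auto
  also have "\<dots> = integral {?R..1} (\<lambda>s. (\<alpha> / 2 * (1 - b) * (1 - b)) * (1 - s) powr (- \<alpha>))"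
    using has_integral_endpoint_singularity[OF assms(2) R(3)] by (simp add: integral_unique)
  also have "\<dots> \<le> integral {?R..1} (kernel_integrand \<alpha> z u)"
  proof (rule integral_le)
    show "(\<lambda>s. (\<alpha> / 2 * (1 - b) * (1 - b)) * (1 - s) powr (- \<alpha>)) integrable_on {?R..1}"
      using has_integral_mult_right[OF has_integral_endpoint_singularity[OF assms(2) R(3)]]
      by (metis has_integral_integrable)
    show "kernel_integrand \<alpha> z u integrable_on {?R..1}"
      using R assms by (intro kernel_integrand_integrable) auto
    fix s assume s: "s \<in> {?R..1}"
    have "\<alpha> / 2 * (1 - b) \<le> \<alpha> / 2 * (1 - z)" using assms by (intro mult_left_mono) auto
    also have "\<dots> \<le> s powr (2 / \<alpha>) * (1 - u) - (1 - \<alpha> / 2) * (1 - z)"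
      using s assms z by (intro kernel_bracket_ge) auto
    finally have 1: "\<alpha> / 2 * (1 - b) \<le> s powr (2 / \<alpha>) * (1 - u) - (1 - \<alpha> / 2) * (1 - z)" .
    have "1 - b \<le> (1 - z) / 1" using assms by simp
    also have "\<dots> \<le> (1 - z) / (1 - u)" using assms z by (intro divide_left_mono) auto
    also have "\<dots> \<le> s powr (2 / \<alpha>)" using s assms z by (intro kernel_start_le) auto
    finally have 2: "1 - b \<le> s powr (2 / \<alpha>)" .
    have "0 \<le> \<alpha> / 2 * (1 - b)" using assms by simp
    then have 3: "0 \<le> s powr (2 / \<alpha>) * (1 - u) - (1 - \<alpha> / 2) * (1 - z)" using 1 by (rule order_trans)
    show "(\<alpha> / 2 * (1 - b) * (1 - b)) * (1 - s) powr (- \<alpha>) \<le> kernel_integrand \<alpha> z u s"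
      unfolding kernel_integrand_def using assms
      by (intro mult_right_mono mult_mono 1 2 3) auto
  qed
  finally have "kernel_factor \<alpha> m * ((\<alpha> / 2 * (1 - b) * (1 - b)) * ((\<alpha> / 2 * (z - u)) powr (1 - \<alpha>) / (1 - \<alpha>)))
     \<le> kernel \<alpha> m z u"
    unfolding kernel_altdef using kernel_factor_pos[OF assms(2,3)] by (intro mult_left_mono) auto
  moreover have "(\<alpha> / 2 * (z - u)) powr (1 - \<alpha>) = (\<alpha> / 2) powr (1 - \<alpha>) * (z - u) powr (1 - \<alpha>)"
    by (rule powr_mult)
  ultimately show ?thesis by (simp add: mult_ac)
qed

lemma kernel_le_power:
  assumes "0 < \<alpha>" "\<alpha> < 1" "0 < m" "0 \<le> u" "u \<le> z" "z \<le> b" "b < 1"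
  shows "kernel \<alpha> m z u \<le> kernel_factor \<alpha> m / (1 - \<alpha>) / (1 - b) powr (1 - \<alpha>) * (z - u) powr (1 - \<alpha>)"
proof -
  let ?R = "kernel_start \<alpha> z u"
  have z: "z < 1" using assms by simp
  note R = kernel_start_bounds[OF assms(1,2,5) z]
  note has = has_integral_endpoint_singularity[OF assms(2) R(3)]
  have "integral {?R..1} (kernel_integrand \<alpha> z u) \<le> integral {?R..1} (\<lambda>s. (1 - s) powr (- \<alpha>))"
  proof (rule integral_le)
    show "(\<lambda>s. (1 - s) powr (- \<alpha>)) integrable_on {?R..1}" using has by (rule has_integral_integrable)
    show "kernel_integrand \<alpha> z u integrable_on {?R..1}"
      using R assms by (intro kernel_integrand_integrable) auto
    fix s assume s: "s \<in> {?R..1}"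
    then have s01: "0 \<le> s" "s \<le> 1" using R by auto
    have s1: "s powr (2 / \<alpha>) \<le> 1" using s01 assms by (intro powr_le1) auto
    have "s powr (2 / \<alpha>) * (1 - u) \<le> 1 * 1" using s1 assms z by (intro mult_mono) auto
    moreover have "0 \<le> (1 - \<alpha> / 2) * (1 - z)" using assms z by (intro mult_nonneg_nonneg) auto
    ultimately have "s powr (2 / \<alpha>) * (1 - u) - (1 - \<alpha> / 2) * (1 - z) \<le> 1" by simp
    then have "(s powr (2 / \<alpha>) * (1 - u) - (1 - \<alpha> / 2) * (1 - z)) * s powr (2 / \<alpha>) \<le> 1 * 1"
      using s1 by (intro mult_mono) auto
    then have "kernel_integrand \<alpha> z u s \<le> (1 * 1) * (1 - s) powr (- \<alpha>)"
      unfolding kernel_integrand_def by (intro mult_right_mono) auto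
    then show "kernel_integrand \<alpha> z u s \<le> (1 - s) powr (- \<alpha>)" by simp
  qed
  also have "\<dots> = (1 - ?R) powr (1 - \<alpha>) / (1 - \<alpha>)" using has by (rule integral_unique)
  also have "\<dots> \<le> ((z - u) / (1 - b)) powr (1 - \<alpha>) / (1 - \<alpha>)"
  proof (intro divide_right_mono powr_mono2)
    have "1 - ?R \<le> 1 - (1 - z) / (1 - u)" using R(2) by simp
    also have "\<dots> = (z - u) / (1 - u)" using assms z by (simp add: field_simps)
    also have "\<dots> \<le> (z - u) / (1 - b)" using assms z by (intro divide_left_mono) auto
    finally show "1 - ?R \<le> (z - u) / (1 - b)" .
  qed (use assms R in auto)
  finally have "kernel \<alpha> m z u \<le> kernel_factor \<alpha> m * (((z - u) / (1 - b)) powr (1 - \<alpha>) / (1 - \<alpha>))"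
    unfolding kernel_altdef using kernel_factor_pos[OF assms(2,3)] by (intro mult_left_mono) auto
  then show ?thesis by (simp add: powr_divide mult_ac)
qed

text \<open>
  The kernel of the equation for \<open>p x = (1 - x) powr (- (2 / m)) * y x\<close>. As \<^const>\<open>kernel\<close> has degree 1
  in \<open>(1 - z, 1 - u)\<close>, a rescaled copy of \<open>y\<close> solves the equation only after multiplication by a
  constant. The exponent \<open>2 / m\<close> is the one that absorbs this constant: it gives the new kernel the
  degree \<open>- 1\<close>, which balances the scaling of \<open>du\<close>.
\<close>

definition scaled_kernel :: "real \<Rightarrow> real \<Rightarrow> real \<Rightarrow> real \<Rightarrow> real" where
  "scaled_kernel \<alpha> m z u = (1 - z) powr (- (2 / m) * (m + 1)) * kernel \<alpha> m z u * (1 - u) powr (2 / m)"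

lemma scaled_kernel_volterra:
  assumes "0 < \<alpha>" "\<alpha> < 1" "0 < m"
  shows "volterra_kernel \<alpha> m (scaled_kernel \<alpha> m)"
proof
  show "0 \<le> scaled_kernel \<alpha> m z u" if "u \<le> z" "z < 1" for u z
    unfolding scaled_kernel_def using kernel_nonneg[OF assms that] by (intro mult_nonneg_nonneg) auto
  show "scaled_kernel \<alpha> m z v \<le> scaled_kernel \<alpha> m z u" if "u \<le> v" "v \<le> z" "z < 1" for u v z
    unfolding scaled_kernel_def
    using that assms kernel_nonneg[of \<alpha> m u z]
    by (intro mult_mono mult_left_mono kernel_antimono powr_mono2) auto
  show "scaled_kernel \<alpha> m (rescale \<sigma> z) (rescale \<sigma> u) = \<sigma> * scaled_kernel \<alpha> m z u"
    if "u \<le> z" "z < 1" "0 < \<sigma>" for u z \<sigma>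
  proof -
    have "- (2 / m) * (m + 1) + 1 + 2 / m = - 1" using assms by (simp add: field_simps)
    moreover have "\<sigma> powr (- (2 / m) * (m + 1)) * \<sigma> * \<sigma> powr (2 / m)
        = \<sigma> powr (- (2 / m) * (m + 1) + 1 + 2 / m)"
      using that by (simp only: powr_add powr_one less_imp_le)
    ultimately have e: "\<sigma> powr (- (2 / m) * (m + 1)) * \<sigma> * \<sigma> powr (2 / m) = 1 / \<sigma>"
      using that by (simp only: powr_minus_divide powr_one less_imp_le)
    have "scaled_kernel \<alpha> m (rescale \<sigma> z) (rescale \<sigma> u)
      = scaled_kernel \<alpha> m z u / (\<sigma> powr (- (2 / m) * (m + 1)) * \<sigma> * \<sigma> powr (2 / m))"
      using that by (simp add: scaled_kernel_def one_minus_rescale kernel_rescale powr_divide)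
    then show ?thesis unfolding e using that by simp
  qed
  fix b :: real assume b: "b < 1"
  show "\<exists>l>0. \<forall>z u. 0 \<le> u \<and> u \<le> z \<and> z \<le> b \<longrightarrow> l * (z - u) powr (1 - \<alpha>) \<le> scaled_kernel \<alpha> m z u"
  proof (intro exI conjI allI impI)
    let ?k = "kernel_factor \<alpha> m * (\<alpha> / 2 * (1 - b) * (1 - b)) * (\<alpha> / 2) powr (1 - \<alpha>) / (1 - \<alpha>)"
    show "0 < ?k * (1 - b) powr (2 / m)" using assms b kernel_factor_pos[of \<alpha> m] by simp
    fix z u assume zu: "0 \<le> u \<and> u \<le> z \<and> z \<le> b"
    have "1 * (?k * (z - u) powr (1 - \<alpha>)) * (1 - b) powr (2 / m) \<le> scaled_kernel \<alpha> m z u"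
      unfolding scaled_kernel_def
    proof (intro mult_mono kernel_ge_power powr_mono2)
      have "1 powr (- (2 / m) * (m + 1)) \<le> (1 - z) powr (- (2 / m) * (m + 1))"
        using assms zu b by (intro powr_mono2') (auto simp: mult_nonpos_nonneg)
      then show "1 \<le> (1 - z) powr (- (2 / m) * (m + 1))" by simp
    qed (use assms b zu kernel_nonneg[OF assms, of u z] kernel_factor_pos[of \<alpha> m] in auto)
    then show "?k * (1 - b) powr (2 / m) * (z - u) powr (1 - \<alpha>) \<le> scaled_kernel \<alpha> m z u"
      by (simp add: mult_ac)
  qed
  show "\<exists>l>0. \<forall>z u. 0 \<le> u \<and> u \<le> z \<and> z \<le> b \<longrightarrow> scaled_kernel \<alpha> m z u \<le> l * (z - u) powr (1 - \<alpha>)"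
  proof (intro exI conjI allI impI)
    let ?k = "kernel_factor \<alpha> m / (1 - \<alpha>) / (1 - b) powr (1 - \<alpha>)"
    let ?c = "(1 - b) powr (- (2 / m) * (m + 1))"
    show "0 < ?c * ?k" using assms b kernel_factor_pos[of \<alpha> m] by simp
    fix z u assume zu: "0 \<le> u \<and> u \<le> z \<and> z \<le> b"
    have "scaled_kernel \<alpha> m z u \<le> ?c * (?k * (z - u) powr (1 - \<alpha>)) * 1"
      unfolding scaled_kernel_def
    proof (intro mult_mono kernel_le_power)
      show "(1 - z) powr (- (2 / m) * (m + 1)) \<le> ?c"
        using assms zu b by (intro powr_mono2') (auto simp: mult_nonpos_nonneg)
      show "(1 - u) powr (2 / m) \<le> 1" using assms zu b by (intro powr_le1) auto
    qed (use assms b zu kernel_nonneg[OF assms, of u z] kernel_factor_pos[of \<alpha> m] in auto)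
    then show "scaled_kernel \<alpha> m z u \<le> ?c * ?k * (z - u) powr (1 - \<alpha>)" by (simp add: mult_ac)
  qed
qed (use assms in auto)

section \<open>The claimed order is below 1\<close>

lemma Gamma_real_le_1:
  fixes x :: real
  assumes "1 \<le> x" "x \<le> 2"
  shows "Gamma x \<le> 1"
proof -
  have "(ln \<circ> Gamma) ((1 - (x - 1)) *\<^sub>R 1 + (x - 1) *\<^sub>R 2) \<le> (1 - (x - 1)) * (ln \<circ> Gamma) 1 + (x - 1) * (ln \<circ> Gamma) (2::real)"
    using assms by (intro convex_onD[OF log_convex_Gamma_real]) auto
  moreover have "Gamma (2::real) = 1" using Gamma_plus1[of "1::real"] by simp
  ultimately have "ln (Gamma x) \<le> 0" by (simp add: algebra_simps)
  then show ?thesis using assms by (simp add: Gamma_real_pos)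
qed

text \<open>
  Log-convexity on \<open>[t + g, 1 + t + g]\<close>, in which \<open>1 + g\<close> is a convex combination with weights \<open>t\<close> and
  \<open>1 - t\<close>, together with the functional equation at \<open>t + g\<close>.
\<close>

lemma Gamma_ratio_le:
  fixes g t :: real
  assumes "0 < g" "0 < t" "t < 1"
  shows "Gamma (1 + g) \<le> Gamma (1 + t + g) * (1 / t) powr t"
proof -
  have "(ln \<circ> Gamma) ((1 - t) *\<^sub>R (1 + t + g) + t *\<^sub>R (t + g))
      \<le> (1 - t) * (ln \<circ> Gamma) (1 + t + g) + t * (ln \<circ> Gamma) (t + g)"
    using assms by (intro convex_onD[OF log_convex_Gamma_real]) auto
  moreover have "(1 - t) *\<^sub>R (1 + t + g) + t *\<^sub>R (t + g) = 1 + g" by (simp add: algebra_simps)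
  moreover have "Gamma (1 + t + g) = (t + g) * Gamma (t + g)"
    using Gamma_plus1[of "t + g"] assms by (simp add: add_ac nonpos_Ints_def)
  moreover from this have "ln (Gamma (1 + t + g)) = ln (t + g) + ln (Gamma (t + g))"
  proof -
    have "0 < t + g" "0 < Gamma (t + g)" using assms by (auto intro: Gamma_real_pos)
    then show ?thesis unfolding \<open>Gamma (1 + t + g) = _\<close> by (rule ln_mult_pos)
  qed
  ultimately have "ln (Gamma (1 + g)) \<le> ln (Gamma (1 + t + g)) - t * ln (t + g)"
    by (simp add: algebra_simps)
  also have "\<dots> \<le> ln (Gamma (1 + t + g)) - t * ln t" using assms by simp
  also have "\<dots> = ln (Gamma (1 + t + g) * (1 / t) powr t)"
  proof -
    have "0 < Gamma (1 + t + g)" "0 < (1 / t) powr t" using assms by (auto intro: Gamma_real_pos)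
    then have "ln (Gamma (1 + t + g) * (1 / t) powr t) = ln (Gamma (1 + t + g)) + ln ((1 / t) powr t)"
      by (rule ln_mult_pos)
    then show ?thesis using assms by (simp add: ln_powr ln_div)
  qed
  finally show ?thesis using assms by (simp add: Gamma_real_pos)
qed

text \<open>
  With \<open>t = 1 - \<alpha>\<close> the left side is at most \<open>(1 / (2 * t)) powr t\<close>, and Bernoulli's inequality bounds
  this by \<open>3 / 2 - t\<close>.
\<close>

lemma Gamma_ratio_le_3_2:
  fixes \<alpha> g :: real
  assumes "0 < g" "0 < \<alpha>" "\<alpha> < 1"
  shows "(\<alpha> / 2) powr (1 - \<alpha>) * Gamma (1 + g) / Gamma (2 - \<alpha> + g) \<le> 3 / 2"
proof -
  define t where "t = 1 - \<alpha>"
  have t: "0 < t" "t < 1" using assms by (auto simp: t_def)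
  have "Gamma (1 + g) / Gamma (1 + t + g) \<le> (1 / t) powr t"
    using Gamma_ratio_le[OF assms(1) t] assms(1) t by (simp add: divide_le_eq Gamma_real_pos mult.commute)
  moreover have "(\<alpha> / 2) powr t \<le> (1 / 2) powr t" using assms t by (intro powr_mono2) auto
  ultimately have "(\<alpha> / 2) powr t * (Gamma (1 + g) / Gamma (1 + t + g)) \<le> (1 / 2) powr t * (1 / t) powr t"
    using assms t by (intro mult_mono) (auto simp: Gamma_real_pos less_imp_le)
  also have "\<dots> = (1 / 2 * (1 / t)) powr t" by (rule powr_mult[symmetric])
  also have "\<dots> \<le> 1 + t * (1 / 2 * (1 / t) - 1)" using t by (intro powr_le_linear) auto
  also have "\<dots> \<le> 3 / 2" using t by (simp add: algebra_simps)
  finally show ?thesis by (simp add: t_def)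
qed

text \<open>
  In both cases of the definition the base of the power is the ratio of the preceding lemma times a
  factor of at most \<open>1 / 2\<close>.
\<close>

lemma C1_pos_le_1:
  assumes "0 < \<alpha>" "\<alpha> < 1" "0 < m"
  shows "0 < C1 \<alpha> m" "C1 \<alpha> m \<le> 1"
proof -
  define g where "g = (2 - \<alpha>) / m"
  have g: "0 < g" using assms by (simp add: g_def)
  define W where "W = (\<alpha> / 2) powr (1 - \<alpha>) * Gamma (1 + g) / Gamma (2 - \<alpha> + g)"
  have W: "0 < W" "W \<le> 3 / 2"
    using Gamma_ratio_le_3_2[OF g assms(1,2)] assms g by (auto simp: W_def Gamma_real_pos)
  have Gg: "Gamma g = Gamma (1 + g) / g" using Gamma_plus1[of g] g by (simp add: add_ac nonpos_Ints_def)
  have base1: "(\<alpha> / 2) powr (1 - \<alpha>) * (Gamma g / Gamma (2 - \<alpha> + g)) * (1 / (2 - \<alpha> + m * (3 - \<alpha>)))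
      = W * (m / ((2 - \<alpha>) * (2 - \<alpha> + m * (3 - \<alpha>))))"
    unfolding Gg W_def using assms by (simp add: g_def mult_ac)
  have base2: "(\<alpha> / 2) powr (2 - \<alpha>) * (Gamma (1 + g) / Gamma (2 - \<alpha> + g)) * (1 / (2 - \<alpha>))
      = W * (\<alpha> / 2 / (2 - \<alpha>))"
  proof -
    have alg: "a * (b / 2) * (c / d) * (1 / k) = a * c / d * (b / 2 / k)" for a b c d k :: real
      by (simp add: mult_ac)
    have eq: "(\<alpha> / 2) powr (2 - \<alpha>) = (\<alpha> / 2) powr (1 - \<alpha>) * (\<alpha> / 2)"
      using assms powr_add[of "\<alpha> / 2" "1 - \<alpha>" 1] by simp
    show ?thesis unfolding W_def eq by (rule alg)
  qed
  have den: "1 * (2 * m) \<le> (2 - \<alpha>) * (2 - \<alpha> + m * (3 - \<alpha>))"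
  proof (rule mult_mono)
    have "0 + m * 2 \<le> (2 - \<alpha>) + m * (3 - \<alpha>)" using assms by (intro add_mono mult_left_mono) auto
    then show "2 * m \<le> 2 - \<alpha> + m * (3 - \<alpha>)" by (simp only: mult.commute[of m 2] add_0_left)
  qed (use assms in auto)
  have f1: "0 < m / ((2 - \<alpha>) * (2 - \<alpha> + m * (3 - \<alpha>)))" "m / ((2 - \<alpha>) * (2 - \<alpha> + m * (3 - \<alpha>))) \<le> 1 / 2"
  proof -
    have "0 < (2 - \<alpha>) * (2 - \<alpha> + m * (3 - \<alpha>))" using den assms by (intro less_le_trans[OF _ den]) auto
    then show "0 < m / ((2 - \<alpha>) * (2 - \<alpha> + m * (3 - \<alpha>)))" "m / ((2 - \<alpha>) * (2 - \<alpha> + m * (3 - \<alpha>))) \<le> 1 / 2"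
      using den assms by (auto simp: divide_le_eq)
  qed
  have f2: "0 < \<alpha> / 2 / (2 - \<alpha>)" "\<alpha> / 2 / (2 - \<alpha>) \<le> 1 / 2" using assms by (auto simp: divide_le_eq)
  have 1: "W * f \<le> 1" if "0 < f" "f \<le> 1 / 2" for f
    using mult_mono[OF W(2) that(2)] W that by simp
  have *: "0 < (W * f) powr (1 / (m + 1))" "(W * f) powr (1 / (m + 1)) \<le> 1" if "0 < f" "f \<le> 1 / 2" for f
    using 1[OF that] W that assms by (auto intro!: powr_le1)
  show "0 < C1 \<alpha> m" "C1 \<alpha> m \<le> 1"
    unfolding C1_def g_def[symmetric] base1 base2 using *[OF f1] *[OF f2] by auto
qed

text \<open>
  As \<open>Gamma (2 - \<alpha>) \<le> 1\<close> and \<open>C1 \<alpha> m \<le> 1\<close>, the subtracted quotient is at least \<open>1 / m\<close>, whereas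
  \<open>\<alpha> + (2 - \<alpha>) / m < 1 + 1 / m\<close>.
\<close>

lemma rate_less_1:
  assumes "0 < \<alpha>" "\<alpha> < 1" "1 < m" "0 < X" "X < 1"
  shows "2 - (2 - \<alpha>) * (1 - 1 / m) - 2 * D_const \<alpha> m X / ((m + 1) * C1 \<alpha> m powr m) < 1"
proof -
  have C1: "0 < C1 \<alpha> m" "C1 \<alpha> m \<le> 1" using C1_pos_le_1 assms by auto
  have G: "0 < Gamma (2 - \<alpha>)" "Gamma (2 - \<alpha>) \<le> 1"
    using assms by (auto intro: Gamma_real_pos Gamma_real_le_1)
  have "1 powr (1 - \<alpha>) \<le> (1 / (1 - X)) powr (1 - \<alpha>)" using assms by (intro powr_mono2) auto
  then have X: "1 \<le> (1 / (1 - X)) powr (1 - \<alpha>)" by simp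
  have "1 * 1 \<le> (1 / Gamma (2 - \<alpha>)) * (1 / (1 - X)) powr (1 - \<alpha>)"
    using G X by (intro mult_mono) auto
  then have "(m + 1) / m * (1 * 1) \<le> (m + 1) / m * ((1 / Gamma (2 - \<alpha>)) * (1 / (1 - X)) powr (1 - \<alpha>))"
    using assms by (intro mult_left_mono) auto
  also have "\<dots> = 2 * D_const \<alpha> m X" by (simp add: D_const_def)
  finally have D: "(m + 1) / m \<le> 2 * D_const \<alpha> m X" by simp
  have Cm: "0 < C1 \<alpha> m powr m" "C1 \<alpha> m powr m \<le> 1" using C1 assms by (auto intro!: powr_le1)
  have "1 / m = (m + 1) / m / (m + 1)" using assms by simp
  also have "\<dots> \<le> 2 * D_const \<alpha> m X / ((m + 1) * C1 \<alpha> m powr m)"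
  proof (rule frac_le)
    show "(m + 1) * C1 \<alpha> m powr m \<le> m + 1" using Cm assms mult_left_mono[of "C1 \<alpha> m powr m" 1 "m + 1"] by simp
    show "0 \<le> 2 * D_const \<alpha> m X" using assms by (intro order_trans[OF _ D]) auto
  qed (use D Cm assms in auto)
  finally have A: "1 / m \<le> 2 * D_const \<alpha> m X / ((m + 1) * C1 \<alpha> m powr m)" .
  have "0 < (1 - \<alpha>) * (1 - 1 / m)" using assms by (intro mult_pos_pos) auto
  then have "2 - (2 - \<alpha>) * (1 - 1 / m) < 1 + 1 / m" by (simp add: algebra_simps diff_divide_distrib)
  then show ?thesis using A by simp
qed

section \<open>Convergence of the scheme\<close>

lemma eventually_grid_limit:
  assumes "0 < z"
  shows "\<forall>\<^sub>F (N, n) in grid_limit X z. k \<le> N \<and> d < real N \<and> z / 2 < real n / real N \<and> real n / real N \<le> X"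
proof -
  have 1: "\<forall>\<^sub>F p in grid_limit X z. k \<le> fst p \<and> d < real (fst p)"
  proof -
    have "\<forall>\<^sub>F N in at_top. k \<le> N \<and> d < real N"
      using eventually_ge_at_top[of k] filterlim_real_sequentially
      by (auto simp: filterlim_at_top_dense eventually_conj_iff)
    then show ?thesis
      unfolding grid_limit_def by (intro filter_leD[OF inf_le1] eventually_filtercomapI)
  qed
  have "\<forall>\<^sub>F p in filtercomap (\<lambda>(N, n). real n / real N) (nhds z). z / 2 < (\<lambda>(N, n). real n / real N) p"
    using assms by (intro eventually_filtercomapI order_tendstoD(1)[OF filterlim_ident]) auto
  then have 2: "\<forall>\<^sub>F p in grid_limit X z. z / 2 < (\<lambda>(N, n). real n / real N) p"
    unfolding grid_limit_def
    by (rule filter_leD[rotated]) (auto intro: le_infI2 le_infI1)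
  have "\<forall>\<^sub>F p in principal {(N, n). real n / real N \<le> X}. (\<lambda>(N, n). real n / real N \<le> X) p"
    by (auto simp: eventually_principal)
  then have 3: "\<forall>\<^sub>F p in grid_limit X z. (\<lambda>(N, n). real n / real N \<le> X) p"
    unfolding grid_limit_def
    by (rule filter_leD[rotated]) (auto intro: le_infI2)
  show ?thesis
    using 1 2 3 by eventually_elim auto
qed

text \<open>
  In the limit at a point \<open>z > 0\<close> the factor \<open>1 / (n h)\<close> stays below \<open>2 / z\<close>.
\<close>

lemma convergence_from_error_bound:
  assumes q: "0 < q" and B: "0 \<le> B"
    and err: "\<And>N n. \<lbrakk>k \<le> N; 0 < N; 0 < n; real n / real N \<le> X\<rbrakk> \<Longrightarrow>
      \<bar>Y N n - y (real n / real N)\<bar> \<le> B * (1 / real N) powr q / (real n / real N)"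
  shows "method_convergent X y Y \<and> convergence_order_at_least X y Y q"
proof -
  have ev: "\<forall>\<^sub>F p in grid_limit X z. \<bar>grid_error y Y p\<bar> \<le> (2 * B / z) * (\<lambda>(N, n). (1 / real N) powr q) p"
    if z: "0 < z" for z
    using eventually_grid_limit[OF z, where k = k and d = 0 and X = X]
  proof eventually_elim
    case (elim p)
    obtain N n where p: "p = (N, n)" by force
    have Nn: "k \<le> N" "0 < N" "0 < n" "real n / real N \<le> X" "z / 2 < real n / real N"
      using elim z by (auto simp: p intro!: Nat.gr0I)
    have "\<bar>grid_error y Y p\<bar> \<le> B * (1 / real N) powr q / (real n / real N)"
      using err[OF Nn(1-4)] by (simp add: grid_error_def p)
    also have "\<dots> \<le> B * (1 / real N) powr q / (z / 2)"
      using Nn z B by (intro divide_left_mono mult_pos_pos) auto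
    finally show ?case by (simp add: p mult_ac)
  qed
  have lim: "((\<lambda>(N, n). (1 / real N) powr q) \<longlongrightarrow> 0) (grid_limit X z)" if z: "0 < z" for z
  proof (rule tendstoI)
    fix e :: real assume e: "0 < e"
    have "\<forall>\<^sub>F p in grid_limit X z. \<bar>(\<lambda>(N, n). (1 / real N) powr q) p\<bar> < e"
      using eventually_grid_limit[OF z, where k = 0 and d = "(1 / e) powr (1 / q)" and X = X]
    proof eventually_elim
      case (elim p)
      obtain N n where p: "p = (N, n)" by force
      have N: "(1 / e) powr (1 / q) < real N" using elim by (simp add: p)
      then have "((1 / e) powr (1 / q)) powr q < real N powr q" using q by (intro powr_less_mono2) auto
      then have "1 / e < real N powr q" using q e by (simp add: powr_powr)
      moreover have "0 < real N" using N by (rule le_less_trans[OF powr_ge_zero])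
      ultimately show ?case using e by (simp add: p powr_divide field_simps)
    qed
    then show "\<forall>\<^sub>F p in grid_limit X z. dist ((\<lambda>(N, n). (1 / real N) powr q) p) 0 < e" by simp
  qed
  have "convergence_order_at_least X y Y q"
    unfolding convergence_order_at_least_def
  proof
    fix z assume "z \<in> {0<..X}"
    then have "0 < z" by simp
    from ev[OF this] show "grid_error y Y \<in> O[grid_limit X z](\<lambda>(N, n). (1 / real N) powr q)"
      by (intro bigoI[of _ "2 * B / z"]) (auto elim!: eventually_mono)
  qed
  moreover have "method_convergent X y Y"
    unfolding method_convergent_def
  proof
    fix z assume "z \<in> {0<..X}"
    then have z: "0 < z" by simp
    have "((\<lambda>p. (2 * B / z) * (\<lambda>(N, n). (1 / real N) powr q) p) \<longlongrightarrow> (2 * B / z) * 0) (grid_limit X z)"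
      by (intro tendsto_mult_left lim z)
    then show "((\<lambda>p. \<bar>grid_error y Y p\<bar>) \<longlongrightarrow> 0) (grid_limit X z)"
      by (intro tendsto_sandwich[OF _ ev[OF z] tendsto_const]) auto
  qed
  ultimately show ?thesis by simp
qed

lemma scaled_solution_volterra:
  assumes \<alpha>: "0 < \<alpha>" "\<alpha> < 1" and m: "0 < m" and y: "nontrivial_solution \<alpha> m y"
  shows "volterra_solution \<alpha> m (scaled_kernel \<alpha> m) (\<lambda>x. if x \<le> 0 then 0 else (1 - x) powr (- (2 / m)) * y x)"
    (is "volterra_solution _ _ _ ?p")
proof -
  interpret volterra_kernel \<alpha> m "scaled_kernel \<alpha> m"
    by (rule scaled_kernel_volterra[OF \<alpha> m])
  have ycont: "continuous_on {0..1} y" and ypos: "\<And>z. \<lbrakk>0 < z; z \<le> 1\<rbrakk> \<Longrightarrow> 0 < y z"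
    and ynonneg: "\<And>z. \<lbrakk>0 \<le> z; z \<le> 1\<rbrakk> \<Longrightarrow> 0 \<le> y z"
    and yeq: "\<And>z. \<lbrakk>0 \<le> z; z \<le> 1\<rbrakk> \<Longrightarrow> y z powr (m + 1) = integral {0..z} (\<lambda>u. kernel \<alpha> m z u * y u)"
    using y by (auto simp: nontrivial_solution_def)
  have y0: "y 0 = 0" using yeq[of 0] by simp
  have p: "?p x = (1 - x) powr (- (2 / m)) * y x" if "0 \<le> x" for x using that y0 by simp
  show ?thesis
  proof
    have "continuous_on {0..<1} (\<lambda>x. (1 - x) powr (- (2 / m)) * y x)"
      by (intro continuous_intros continuous_on_subset[OF ycont]) auto
    then show "continuous_on {0..<1} ?p" by (rule continuous_on_eq) (use y0 in auto)
    show "?p x = 0" if "x \<le> 0" for x using that by simp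
    show "0 < ?p x" if "0 < x" "x < 1" for x using that ypos[of x] by simp
    fix x :: real assume x: "0 \<le> x" "x < 1"
    have "?p x powr (m + 1) = (1 - x) powr (- (2 / m) * (m + 1)) * y x powr (m + 1)"
      by (simp only: p[OF x(1)] powr_mult powr_powr)
    also have "\<dots> = integral {0..x} (\<lambda>u. (1 - x) powr (- (2 / m) * (m + 1)) * (kernel \<alpha> m x u * y u))"
      using yeq[of x] x by simp
    also have "\<dots> = integral {0..x} (\<lambda>u. scaled_kernel \<alpha> m x u * ?p u)"
    proof (rule integral_cong)
      fix u assume u: "u \<in> {0..x}"
      then have "(1 - u) powr (2 / m) * (1 - u) powr (- (2 / m)) = 1"
        using x by (simp add: powr_add[symmetric])
      then have "scaled_kernel \<alpha> m x u * ?p u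
          = (1 - x) powr (- (2 / m) * (m + 1)) * kernel \<alpha> m x u * y u * 1"
        using u unfolding scaled_kernel_def by (subst p) (auto simp: mult_ac)
      then show "(1 - x) powr (- (2 / m) * (m + 1)) * (kernel \<alpha> m x u * y u) = scaled_kernel \<alpha> m x u * ?p u"
        by (simp only: mult_1_right mult.assoc)
    qed
    finally show "?p x powr (m + 1) = integral {0..x} (\<lambda>u. scaled_kernel \<alpha> m x u * ?p u)" .
  qed
qed

lemma midpoint_scheme_scaled:
  assumes \<alpha>: "0 < \<alpha>" "\<alpha> < 1" and m: "0 < m" and X: "X < 1" and N: "1 \<le> N"
    and v: "midpoint_scheme \<alpha> m X N v"
  shows "volterra_kernel.midpoint_recursion m (scaled_kernel \<alpha> m) X (1 / real N)
    (\<lambda>n. (1 - real n * (1 / real N)) powr (- (2 / m)) * v n)"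
proof -
  interpret volterra_kernel \<alpha> m "scaled_kernel \<alpha> m"
    by (rule scaled_kernel_volterra[OF \<alpha> m])
  define h where "h = 1 / real N"
  define V where "V n = (1 - real n * h) powr (- (2 / m)) * v n" for n
  have h: "0 < h" using N by (simp add: h_def)
  have vV: "scaled_kernel \<alpha> m (real n * h) (real j * h) * V j
      = (1 - real n * h) powr (- (2 / m) * (m + 1)) * (kernel \<alpha> m (real n * h) (real j * h) * v j)"
    if "real n * h \<le> X" "j \<le> n" for n j
  proof -
    have "real j * h \<le> real n * h" using that h by (intro mult_right_mono) auto
    then have "(1 - real j * h) powr (2 / m) * (1 - real j * h) powr (- (2 / m)) = 1"
      using that X by (simp add: powr_add[symmetric])
    moreover have "scaled_kernel \<alpha> m (real n * h) (real j * h) * V j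
      = (1 - real n * h) powr (- (2 / m) * (m + 1)) * (kernel \<alpha> m (real n * h) (real j * h) * v j)
        * ((1 - real j * h) powr (2 / m) * (1 - real j * h) powr (- (2 / m)))"
      by (simp only: scaled_kernel_def V_def mult_ac)
    ultimately show ?thesis by simp
  qed
  have "midpoint_recursion X h V"
    unfolding midpoint_recursion_def
  proof (intro conjI allI impI ballI)
    show "V 0 = 0" using v by (simp add: V_def midpoint_scheme_def Let_def)
    fix q k :: nat assume q: "1 \<le> q" and k: "k \<in> {0, 1}" and le: "real (2 * q + k) * h \<le> X"
    define n where "n = 2 * q + k"
    have v0: "0 \<le> v n" and vn: "v n powr (m + 1) = 1 / 2 * h * kernel \<alpha> m (real n * h) (real k * h) * v k
        + 2 * h * (\<Sum>i = 1..q. kernel \<alpha> m (real n * h) (real (2 * i + k - 1) * h) * v (2 * i + k - 1))"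
      using v q k le unfolding midpoint_scheme_def Let_def h_def n_def by blast+
    show "0 \<le> V (2 * q + k)" using v0 by (simp add: V_def n_def)
    let ?c = "(1 - real n * h) powr (- (2 / m) * (m + 1))"
    have "V n powr (m + 1) = ?c * v n powr (m + 1)" by (simp only: V_def powr_mult powr_powr)
    also have "\<dots> = h / 2 * (?c * (kernel \<alpha> m (real n * h) (real k * h) * v k))
        + 2 * h * (\<Sum>i = 1..q. ?c * (kernel \<alpha> m (real n * h) (real (2 * i + k - 1) * h) * v (2 * i + k - 1)))"
      unfolding vn sum_distrib_left[symmetric] by (simp add: algebra_simps)
    also have "\<dots> = h / 2 * (scaled_kernel \<alpha> m (real n * h) (real k * h) * V k)
        + 2 * h * (\<Sum>i = 1..q. scaled_kernel \<alpha> m (real n * h) (real (2 * i + k - 1) * h) * V (2 * i + k - 1))"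
      using le q k by (intro arg_cong2[where f = "(+)"] arg_cong2[where f = "(*)"] sum.cong refl vV[symmetric])
        (auto simp: n_def)
    finally show "V (2 * q + k) powr (m + 1) =
        h / 2 * scaled_kernel \<alpha> m (real (2 * q + k) * h) (real k * h) * V k
        + 2 * h * (\<Sum>i = 1..q. scaled_kernel \<alpha> m (real (2 * q + k) * h) (real (2 * i + k - 1) * h) * V (2 * i + k - 1))"
      by (simp only: n_def[symmetric] mult.assoc)
  qed
  then show ?thesis by (simp only: V_def[abs_def] h_def)
qed

theorem corollary1:
  fixes \<alpha> m X :: real and y :: "real \<Rightarrow> real" and Y :: "nat \<Rightarrow> nat \<Rightarrow> real"
  assumes "0 < \<alpha>" and "\<alpha> < 1" and "1 < m" and "0 < X" and "X < 1"
    and "nontrivial_solution \<alpha> m y"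
    and "\<And>N. 1 \<le> N \<Longrightarrow> midpoint_scheme \<alpha> m X N (Y N)"
    and "2 - \<alpha> < m"
    and "2 * D_const \<alpha> m X / ((m + 1) * C1 \<alpha> m powr m) < \<alpha> + (2 - \<alpha>) / m"
  shows "method_convergent X y Y \<and>
    convergence_order_at_least X y Y
      (2 - (2 - \<alpha>) * (1 - 1 / m) - 2 * D_const \<alpha> m X / ((m + 1) * C1 \<alpha> m powr m))"
proof -
  have m: "0 < m" using assms(3) by simp
  define p where "p = (\<lambda>x. if x \<le> 0 then 0 else (1 - x) powr (- (2 / m)) * y x)"
  interpret volterra_solution \<alpha> m "scaled_kernel \<alpha> m" p
    unfolding p_def by (rule scaled_solution_volterra[OF assms(1,2) m assms(6)])
  define q where "q = 2 - (2 - \<alpha>) * (1 - 1 / m) - 2 * D_const \<alpha> m X / ((m + 1) * C1 \<alpha> m powr m)"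
  have q1: "q < 1" unfolding q_def using assms by (intro rate_less_1) auto
  have "2 - (2 - \<alpha>) * (1 - 1 / m) = \<alpha> + (2 - \<alpha>) / m"
    using m by (simp add: field_simps)
  then have q0: "0 < q" unfolding q_def using assms(9) by simp
  define c where "c = (\<alpha> / 2) powr (2 - \<alpha>) * (Gamma \<gamma> / Gamma (1 - \<alpha> + \<gamma>)) / ((2 - \<alpha>) * (1 + 1 / m) - 1)"
  have "(2 - \<alpha>) * (1 + 1 / m) - 1 = 1 - \<alpha> + \<gamma>" using m by (simp add: \<gamma>_def field_simps)
  moreover have "0 < Gamma (1 - \<alpha> + \<gamma>)" using assms \<gamma>_pos by (intro Gamma_real_pos) auto
  ultimately have c: "0 < c" unfolding c_def using assms \<gamma>_pos by (simp add: Gamma_real_pos)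
  define c' where "c' = (1 / 2) powr (- (2 / m)) * c"
  have c': "0 < c'" using c by (simp add: c'_def)
  obtain B h0 where B: "0 < B" "0 < h0"
    "\<And>h V n. \<lbrakk>0 < h; h \<le> h0; midpoint_recursion X h V; c * h powr \<gamma> \<le> V 1; V 1 \<le> c' * h powr \<gamma>;
      0 < n; real n * h \<le> X\<rbrakk> \<Longrightarrow>
      \<bar>V n - p (real n * h)\<bar> \<le> B * h powr (1 - (1 - q)) / (real n * h)"
    using midpoint_error[OF assms(4,5), of "1 - q" c c'] q0 q1 c c' by auto
  have "method_convergent X y Y \<and> convergence_order_at_least X y Y q"
  proof (rule convergence_from_error_bound[where B = B and k = "max 2 (nat \<lceil>1 / h0\<rceil>)"])
    fix N n :: nat
    assume N: "max 2 (nat \<lceil>1 / h0\<rceil>) \<le> N" "0 < N" and n: "0 < n" "real n / real N \<le> X"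
    define h where "h = 1 / real N"
    define V where "V j = (1 - real j * h) powr (- (2 / m)) * Y N j" for j
    have h: "0 < h" "h \<le> 1 / 2" using N by (auto simp: h_def field_simps)
    have "h \<le> h0"
    proof -
      have "1 / h0 \<le> real N" using N by linarith
      then show ?thesis using B(2) N by (simp add: h_def field_simps)
    qed
    moreover have "midpoint_recursion X h V"
      unfolding V_def h_def using N
      by (intro midpoint_scheme_scaled[OF assms(1,2) m assms(5) _ assms(7)]) auto
    moreover have "c * h powr \<gamma> \<le> V 1" "V 1 \<le> c' * h powr \<gamma>"
    proof -
      \<comment> \<open>The starting value is a multiple of \<open>h powr \<gamma>\<close>, like \<open>p h\<close> up to bounded factors, so that both
        comparisons can start at the first node.\<close>
      have Y1: "Y N 1 = c * h powr \<gamma>"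
        using assms(7)[of N] N by (simp add: midpoint_scheme_def Let_def c_def \<gamma>_def h_def)
      have "1 powr (- (2 / m)) \<le> (1 - h) powr (- (2 / m))"
        using h m by (intro powr_mono2') auto
      then have "1 * (c * h powr \<gamma>) \<le> (1 - h) powr (- (2 / m)) * (c * h powr \<gamma>)"
        using c by (intro mult_right_mono) auto
      then show "c * h powr \<gamma> \<le> V 1" by (simp add: V_def Y1[unfolded One_nat_def])
      have "(1 - h) powr (- (2 / m)) \<le> (1 / 2) powr (- (2 / m))"
        using h m by (intro powr_mono2') auto
      then have "(1 - h) powr (- (2 / m)) * (c * h powr \<gamma>) \<le> (1 / 2) powr (- (2 / m)) * (c * h powr \<gamma>)"
        using c by (intro mult_right_mono) auto
      then show "V 1 \<le> c' * h powr \<gamma>" by (simp add: V_def Y1[unfolded One_nat_def] c'_def)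
    qed
    moreover have z: "real n * h \<le> X" "real n * h = real n / real N" using n by (simp_all add: h_def)
    ultimately have err: "\<bar>V n - p (real n * h)\<bar> \<le> B * h powr (1 - (1 - q)) / (real n * h)"
      using h n by (intro B(3)) auto
    define z where "z = real n * h"
    have "0 < z" using h n by (simp add: z_def)
    moreover have "z < 1" using z(1) assms(5) by (simp add: z_def)
    ultimately have zz: "0 < z" "z < 1" .
    have "(1 - z) powr (- (2 / m)) * \<bar>Y N n - y z\<bar> = \<bar>V n - p z\<bar>"
      using zz by (simp add: V_def p_def z_def[symmetric] abs_mult right_diff_distrib[symmetric])
    moreover have "1 powr (- (2 / m)) \<le> (1 - z) powr (- (2 / m))"
      using zz m by (intro powr_mono2') auto
    then have "1 * \<bar>Y N n - y z\<bar> \<le> (1 - z) powr (- (2 / m)) * \<bar>Y N n - y z\<bar>"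
      by (intro mult_right_mono) auto
    ultimately show "\<bar>Y N n - y (real n / real N)\<bar> \<le> B * (1 / real N) powr q / (real n / real N)"
      using err z(2) by (simp add: z_def h_def)
  qed (use q0 B in auto)
  then show ?thesis by (simp only: q_def)
qed

end
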